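(* Gosset's polytope $4_{21}$ has exactly $2^{130}$ fifteen-fold parity proofs.
   Context: Gosset's polytope $4_{21}$ is the uniform polytope in $\mathbb{R}^8$ whose 240 vertices are the roots of $E_8$, centered at the origin. Its rays are the 120 undirected lines through antipodal pairs of vertices, and a basis is a set of eight mutually orthogonal rays; there are 2025 bases. The triacontagonal projection is the orthogonal projection to a plane (the Coxeter plane of $E_8$) in which the vertices lie on concentric regular 30-gons. Let $g$ be the orthogonal symmetry of the polytope that preserves this plane and rotates it by $24^\circ$, namely the square of the Coxeter element that rotates the plane by $12^\circ$; since the 15th power of the Coxeter element is $-1$, $g$ has order 15 on rays and generates the same group of permutations of the rays as the Coxeter element. Under $g$ the 120 rays form 8 orbits of fifteen rays and the 2025 bases form 135 orbits of fifteen bases. A parity proof is a set of bases consisting of an odd number of bases such that each ray occurs in an even number (possibly zero) of the bases of the set. It is fifteen-fold if it is invariant under $g$. *)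

theory Defs
  imports "HOL-Analysis.Analysis"
begin

text \<open>The roots of \<open>E\<^sub>8\<close>, in the standard coordinates: the vectors of squared norm 2 in the
  even unimodular lattice of all vectors whose coordinates are either all integers or all
  half-integers (elements of \<open>\<int> + 1/2\<close>) and have an even sum.\<close>

definition E8_lattice :: "(real ^ 8) set" where
  "E8_lattice = {x. ((\<forall>i. x $ i \<in> \<int>) \<or> (\<forall>i. x $ i - 1/2 \<in> \<int>)) \<and> (\<Sum>i\<in>UNIV. x $ i) / 2 \<in> \<int>}"

definition E8_roots :: "(real ^ 8) set" where
  "E8_roots = {x \<in> E8_lattice. x \<bullet> x = 2}"

definition gosset_polytope :: "(real ^ 8) set" where
  "gosset_polytope = convex hull E8_roots"

definition gosset_vertices :: "(real ^ 8) set" where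
  "gosset_vertices = {v. v extreme_point_of gosset_polytope}"

lemma extreme_point_of_convex_hull_sphere:
  fixes S :: "'a::euclidean_space set"
  assumes S: "\<And>x. x \<in> S \<Longrightarrow> norm x = r" and v: "v \<in> S"
  shows "v extreme_point_of (convex hull S)"
proof -
  have sub: "convex hull S \<subseteq> cball 0 r"
    using S by (intro hull_minimal) auto
  have "v \<notin> open_segment a b" if "a \<in> convex hull S" "b \<in> convex hull S" for a b
  proof
    assume *: "v \<in> open_segment a b"
    have "dist 0 v < dist 0 a \<or> dist 0 v < dist 0 b"
      using * by (rule dist_decreases_open_segment[rule_format])
    moreover have "norm a \<le> r" "norm b \<le> r" "norm v = r"
      using sub that S v by auto
    ultimately show False by simp
  qed
  then show ?thesis
    using v by (auto simp: extreme_point_of_def hull_inc)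
qed

lemma gosset_vertices_eq: "gosset_vertices = E8_roots"
proof -
  have "norm x = sqrt 2" if "x \<in> E8_roots" for x
    using that by (simp add: E8_roots_def norm_eq_sqrt_inner)
  then show ?thesis
    using extreme_point_of_convex_hull extreme_point_of_convex_hull_sphere
    unfolding gosset_vertices_def gosset_polytope_def by blast
qed

definition polytope_symmetry :: "(real ^ 8 \<Rightarrow> real ^ 8) \<Rightarrow> bool" where
  "polytope_symmetry f \<longleftrightarrow> orthogonal_transformation f \<and> f ` gosset_polytope = gosset_polytope"

definition orthonormal_frame :: "'a::euclidean_space set \<Rightarrow> 'a \<Rightarrow> 'a \<Rightarrow> bool" where
  "orthonormal_frame P e1 e2 \<longleftrightarrow>
     norm e1 = 1 \<and> norm e2 = 1 \<and> orthogonal e1 e2 \<and> span {e1, e2} = P"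

text \<open>The vertex set of a regular \<open>n\<close>-gon in the plane \<open>P\<close>, centred at the origin.\<close>

definition regular_ngon :: "nat \<Rightarrow> 'a::euclidean_space set \<Rightarrow> 'a set \<Rightarrow> bool" where
  "regular_ngon n P S \<longleftrightarrow>
     (\<exists>e1 e2 r. orthonormal_frame P e1 e2 \<and> r > 0 \<and>
        S = {r *\<^sub>R (cos (2 * pi * real k / real n) *\<^sub>R e1 + sin (2 * pi * real k / real n) *\<^sub>R e2) | k. k < n})"

text \<open>On a linear subspace, \<^const>\<open>closest_point\<close> is the orthogonal projection.\<close>

definition triacontagonal_plane :: "(real ^ 8) set \<Rightarrow> bool" where
  "triacontagonal_plane P \<longleftrightarrow>
     subspace P \<and> dim P = 2 \<and>
     (\<exists>F. (\<forall>S\<in>F. regular_ngon 30 P S) \<and> closest_point P ` gosset_vertices = \<Union>F)"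

text \<open>The frame, hence the orientation of \<open>P\<close>, is arbitrary. For linear \<open>f\<close> it follows that \<open>f ` P = P\<close>.\<close>

definition rotates_plane_by :: "('a::euclidean_space \<Rightarrow> 'a) \<Rightarrow> 'a set \<Rightarrow> real \<Rightarrow> bool" where
  "rotates_plane_by f P \<theta> \<longleftrightarrow>
     (\<exists>e1 e2. orthonormal_frame P e1 e2 \<and>
        f e1 = cos \<theta> *\<^sub>R e1 + sin \<theta> *\<^sub>R e2 \<and>
        f e2 = - sin \<theta> *\<^sub>R e1 + cos \<theta> *\<^sub>R e2)"

definition rays :: "(real ^ 8) set set" where
  "rays = (\<lambda>v. span {v}) ` gosset_vertices"

definition orthogonal_rays :: "(real ^ 8) set \<Rightarrow> (real ^ 8) set \<Rightarrow> bool" where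
  "orthogonal_rays R S \<longleftrightarrow> (\<forall>x\<in>R. \<forall>y\<in>S. orthogonal x y)"

definition bases :: "(real ^ 8) set set set" where
  "bases = {B. B \<subseteq> rays \<and> card B = 8 \<and> pairwise orthogonal_rays B}"

definition parity_proof :: "(real ^ 8) set set set \<Rightarrow> bool" where
  "parity_proof X \<longleftrightarrow>
     X \<subseteq> bases \<and> odd (card X) \<and> (\<forall>R\<in>rays. even (card {B \<in> X. R \<in> B}))"

definition fifteen_fold :: "(real ^ 8 \<Rightarrow> real ^ 8) \<Rightarrow> (real ^ 8) set set set \<Rightarrow> bool" where
  "fifteen_fold g X \<longleftrightarrow> (\<lambda>B. (\<lambda>R. g ` R) ` B) ` X = X"

end

theory Submission
  imports Defs "HOL-Library.Z2" "HOL-Computational_Algebra.Polynomial_Factorial"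
begin

text \<open>No root projects to 0 on \<open>P\<close>, so every integral relation between the vectors \<open>g\<^sup>i v\<close> of a root
  \<open>v\<close> is a relation between the powers of a primitive fifteenth root of unity. As the fifteenth
  cyclotomic polynomial is irreducible of degree 8, it annihilates \<open>g\<close>. Consequently the inner products
  \<open>v \<bullet> g\<^sup>k v\<close> leave eight possibilities, one for each pair of opposite orbits of roots, and some root
  \<open>v\<close> realises a prescribed one. Then \<open>v, g v, \<dots>, g\<^sup>7 v\<close> is a basis of the lattice whose Gram
  matrix has determinant 1, and everything reduces to the lattice modulo 2: rays become the 120 vectors
  with \<open>q = 1\<close> of an 8-dimensional quadratic space over the field with two elements, and bases become
  certain three-dimensional affine subspaces.

  The functions \<open>x \<bullet> g\<^sup>k x mod 2\<close> for \<open>k = 1, 2, 3\<close> separate the eight orbits of rays, which are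
  thereby identified with the points of an affine 3-space over the field with two elements. Being
  quadratic, these functions sum to 0 over each basis, so the parities with which a basis meets the
  orbits form an affine function on that 3-space. The parity conditions therefore have rank 4
  instead of 8, and with the condition of odd cardinality they cut the \<open>2\<^sup>1\<^sup>3\<^sup>5\<close> sets of orbits of bases
  down to \<open>2\<^sup>1\<^sup>3\<^sup>0\<close>.\<close>

text \<open>The plane and the rotation are known only through geometric properties, so no matrix of
  a Coxeter element is at hand: a coordinate system has to be extracted from \<open>g\<close>
  itself. Once that is done, all admissible pairs of plane and rotation lead to one and the same
  model, in which finite checks suffice. That the parities form an affine function is a duality
  statement. The parity vector of a basis is orthogonal to the constants and to the three coordinate
  functions on the 3-space, and the first-order Reed-Muller code of length 8 is self-dual. Freeness
  of the cyclic action, on vectors and on bases, is what turns parities of single bases into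
  conditions on orbits: the bases of an orbit that contain a given ray are as many as the rays of
  that ray's orbit in one basis. As 15 is odd, the number of bases in a union of orbits has the
  parity of the number of orbits. The exponent is 135 - 5. Four incidence conditions and the oddness
  condition are independent because explicit bases exist whose parities at the points 0, e1, e2, e3
  are all zero or form any one of the unit vectors.\<close>

section \<open>The quadratic space of dimension 8 over the field with two elements\<close>

text \<open>Without this, the simplifier replaces the ring operations by Boolean ones.\<close>

declare add_bit_eq_xor [simp del] mult_bit_eq_and [simp del]

type_synonym vec8 = "bit \<times> bit \<times> bit \<times> bit \<times> bit \<times> bit \<times> bit \<times> bit"

text \<open>Half the norm form, modulo 2, of a lattice with basis \<open>u\<^sub>0, \<dots>, u\<^sub>7\<close> in which
  \<open>u\<^sub>i \<bullet> u\<^sub>i\<^sub>+\<^sub>k\<close> is 2, 0, 0, 0, 1, -1, -1, 0 for \<open>k = 0, \<dots>, 7\<close>; the map \<open>sh\<close> below is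
  multiplication by the variable modulo the fifteenth cyclotomic polynomial.\<close>

fun qf :: "vec8 \<Rightarrow> bit" where
  "qf (a,b,c,d,e,f,g,h) = a + b + c + d + e + f + g + h
     + (a*e + b*f + c*g + d*h) + (a*f + b*g + c*h) + (a*g + b*h)"

fun bf :: "vec8 \<Rightarrow> vec8 \<Rightarrow> bit" where
  "bf (a,b,c,d,e,f,g,h) (a',b',c',d',e',f',g',h') =
     (a*e' + b*f' + c*g' + d*h') + (a*f' + b*g' + c*h') + (a*g' + b*h') +
     (a'*e + b'*f + c'*g + d'*h) + (a'*f + b'*g + c'*h) + (a'*g + b'*h)"

fun sh :: "vec8 \<Rightarrow> vec8" where
  "sh (a,b,c,d,e,f,g,h) = (h, a + h, b, c + h, d + h, e + h, f, g + h)"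

lemma bit_self: "x + x = (0::bit)" for x by (cases x; simp)

lemma bit_left_cancel: "x + (x + y) = (y::bit)" for x y by (cases x; cases y; simp)

lemma bit_mult_self: "x * x = (x::bit)" for x by (cases x; simp)

lemma bit_mult_left: "x * (x * y) = (x * y::bit)" for x y by (cases x; simp)

lemmas bit_simps = algebra_simps bit_self bit_left_cancel bit_mult_self bit_mult_left

lemma vec8_cases: obtains a b c d e f g h where "x = ((a,b,c,d,e,f,g,h)::vec8)"
  by (cases x) auto

lemma qf_sh: "qf (sh x) = qf x"
  by (cases x rule: vec8_cases) (simp add: bit_simps)

lemma qf_add: "qf (x + y) = qf x + qf y + bf x y"
  by (cases x rule: vec8_cases; cases y rule: vec8_cases; simp add: bit_simps)

lemma bf_add: "bf (x + y) z = bf x z + bf y z"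
  by (cases x rule: vec8_cases; cases y rule: vec8_cases; cases z rule: vec8_cases; simp add: bit_simps)

lemma bf_commute: "bf x y = bf y x"
  by (cases x rule: vec8_cases; cases y rule: vec8_cases; simp add: bit_simps)

lemma sh_add: "sh (x + y) = sh x + sh y"
  by (cases x rule: vec8_cases; cases y rule: vec8_cases; simp add: bit_simps)

lemma sh_15: "(sh ^^ 15) x = x"
  by (cases x rule: vec8_cases) (simp add: bit_simps eval_nat_numeral)

text \<open>The fifteenth cyclotomic polynomial divides \<open>1 + X^5 + X^10\<close>. The relation
  excludes nonzero fixed vectors of the fifth power.\<close>

lemma sh_5: "x + (sh ^^ 5) x + (sh ^^ 10) x = 0"
  by (cases x rule: vec8_cases) (simp add: bit_simps eval_nat_numeral zero_prod_def)

lemma UNIV_bit: "(UNIV::bit set) = {0,1}" by (auto intro: bit.exhaust)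

instance bit :: finite
  by standard (simp add: UNIV_bit)

lemma CARD_bit [simp]: "CARD(bit) = 2"
  by (simp add: UNIV_bit)

lemma card_vec8: "CARD(vec8) = 256" by simp

section \<open>Orbits of the shift on the vectors with \<open>qf = 1\<close>\<close>

definition orbit_type :: "vec8 \<Rightarrow> bit \<times> bit \<times> bit" where
  "orbit_type x = (bf x (sh x), bf x (sh (sh x)), bf x (sh (sh (sh x))))"

text \<open>One vector for each value of \<open>orbit_type\<close>. With suitable signs each of them
  lifts to an integral combination of norm 2; see \<open>orbit_rep_lift\<close>.\<close>

fun orbit_rep :: "bit \<times> bit \<times> bit \<Rightarrow> vec8" where
 "orbit_rep (a,b,c) = (if a=0 then if b=0 then if c=0 then (1,0,0,0,0,0,0,0) else (1,1,0,0,1,0,1,1)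
                 else if c=0 then (1,0,0,0,1,0,1,0) else (1,1,1,0,1,0,1,0)
                 else if b=0 then if c=0 then (1,1,0,0,0,0,1,1) else (1,1,0,1,1,0,1,1)
                 else if c=0 then (1,0,0,0,1,0,0,0) else (1,0,0,0,0,0,1,0))"

fun walk :: "nat \<Rightarrow> vec8 \<Rightarrow> vec8 list" where
  "walk 0 x = []"
| "walk (Suc n) x = x # walk n (sh x)"

lemma in_walk_iff: "y \<in> set (walk n x) \<longleftrightarrow> (\<exists>k<n. y = (sh ^^ k) x)"
proof (induction n arbitrary: x)
  case (Suc n)
  have "(\<exists>k<Suc n. y = (sh ^^ k) x) \<longleftrightarrow> y = x \<or> (\<exists>k<n. y = (sh ^^ Suc k) x)"
    by (subst Ex_less_Suc2) simp
  with Suc show ?case by (simp add: funpow_swap1)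
qed simp

text \<open>A check of all 256 vectors. There is no slack: eight types with at most 15 vectors each
  have to cover the 120 vectors with \<open>qf = 1\<close>, so the type is a complete invariant of
  the orbit.\<close>

lemma walk_orbit_rep: "qf x = 1 \<Longrightarrow> x \<in> set (walk 15 (orbit_rep (orbit_type x)))"
proof (cases x rule: vec8_cases)
  case (1 a b c d e f g h)
  show "qf x = 1 \<Longrightarrow> x \<in> set (walk 15 (orbit_rep (orbit_type x)))"
    unfolding 1
    by (cases a; cases b; cases c; cases d; cases e; cases f; cases g; cases h;
        simp add: orbit_type_def eval_nat_numeral)
qed

section \<open>Bases of mutually orthogonal vectors\<close>

text \<open>The number 120 marks the form of plus type, with Witt index 4; the other nondegenerate
  form on 256 vectors has 136 vectors with \<open>q = 1\<close>.\<close>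

locale quadratic_space =
  fixes q :: "'v::{finite,ab_group_add} \<Rightarrow> bit" and bf :: "'v \<Rightarrow> 'v \<Rightarrow> bit"
  assumes vec_self [simp]: "x + x = (0::'v)"
    and q_add: "q (x + y) = q x + q y + bf x y"
    and bf_add: "bf (x + y) z = bf x z + bf y z"
    and bf_commute: "bf x y = bf y x"
    and bf_nondegenerate: "(\<And>x. bf x s = 0) \<Longrightarrow> s = 0"
    and card_UNIV: "CARD('v) = 256"
    and card_singular_compl: "card {x. q x = 1} = 120"
begin

lemma vec_left_cancel [simp]: "x + (x + y) = (y::'v)"
  by (simp flip: add.assoc)

lemma vec_eq_iff_add: "x = y \<longleftrightarrow> x + y = (0::'v)"
  by (metis add.right_neutral vec_left_cancel vec_self)

lemma bf_add_right: "bf z (x + y) = bf z x + bf z y"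
  by (metis bf_add bf_commute)

lemma bf_zero [simp]: "bf 0 x = 0" "bf x 0 = 0"
  using bf_add[of 0 0 x] bf_add_right[of x 0 0] by simp_all

lemma q_zero [simp]: "q 0 = 0"
  using q_add[of 0 0] by (metis add.right_neutral bf_zero(1) bit_self)

lemma bf_self [simp]: "bf x x = 0"
  using q_add[of x x] by (simp add: bit_self)

section \<open>Orthogonal complements and their sizes\<close>

definition perp :: "'v list \<Rightarrow> 'v set" where
  "perp rs = {x. \<forall>r\<in>set rs. bf x r = 0}"

primrec subset_sums :: "'v list \<Rightarrow> 'v set" where
  "subset_sums [] = {0}"
| "subset_sums (r # rs) = subset_sums rs \<union> (+) r ` subset_sums rs"

lemma perp_Nil: "perp [] = UNIV"
  by (simp add: perp_def)

lemma perp_Cons: "perp (r # rs) = {x \<in> perp rs. bf x r = 0}"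
  by (auto simp: perp_def)

lemma perp_add: "x \<in> perp rs \<Longrightarrow> y \<in> perp rs \<Longrightarrow> x + y \<in> perp rs"
  by (simp add: perp_def bf_add)

text \<open>Over the field with two elements \<open>subset_sums rs\<close> is the span of
  \<open>rs\<close>. In the induction step, on \<open>perp rs\<close> the functional of
  \<open>r\<close> vanishes wherever that of \<open>s\<close> does. If it is not zero there, the two
  functionals agree on \<open>perp rs\<close>, and the induction hypothesis applies to
  \<open>s + r\<close>.\<close>

lemma double_perp:
  assumes "\<And>x. x \<in> perp rs \<Longrightarrow> bf x r = 0"
  shows "r \<in> subset_sums rs"
  using assms
proof (induction rs arbitrary: r)
  case Nil
  then show ?case using bf_nondegenerate[of r] by (simp add: perp_Nil)
next
  case (Cons s rs)
  show ?case
  proof (cases "\<forall>x\<in>perp rs. bf x r = 0")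
    case True
    with Cons.IH show ?thesis by simp
  next
    case False
    then obtain x0 where x0: "x0 \<in> perp rs" "bf x0 r = 1" by auto
    have x0s: "bf x0 s = 1"
    proof (rule ccontr)
      assume "bf x0 s \<noteq> 1"
      then have "x0 \<in> perp (s # rs)" by (simp add: perp_Cons x0)
      from Cons.prems[OF this] x0 show False by simp
    qed
    have "bf x (s + r) = 0" if x: "x \<in> perp rs" for x
    proof (cases "bf x s = 0")
      case True
      with Cons.prems[of x] x show ?thesis by (simp add: perp_Cons bf_add_right)
    next
      case False
      then have "x + x0 \<in> perp (s # rs)"
        using x x0 x0s by (simp add: perp_Cons perp_add bf_add)
      from Cons.prems[OF this] have "bf x r + 1 = 0" by (simp add: bf_add x0)
      then have "bf x r = 1" by (cases "bf x r") auto
      with False show ?thesis by (simp add: bf_add_right)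
    qed
    then have "s + r \<in> subset_sums rs" by (rule Cons.IH)
    then have "s + (s + r) \<in> (+) s ` subset_sums rs" by blast
    then show ?thesis by simp
  qed
qed

text \<open>Translation by \<open>t\<close> is an involution of \<open>S\<close> that exchanges the
  two level sets of \<open>f\<close>.\<close>

lemma card_flip:
  fixes f :: "'v \<Rightarrow> bit"
  assumes S: "\<And>x. x \<in> S \<Longrightarrow> x + t \<in> S" and f: "\<And>x. x \<in> S \<Longrightarrow> f (x + t) = f x + 1"
  shows "2 * card {x \<in> S. f x = c} = card S"
proof -
  have flip: "y + 1 = c \<longleftrightarrow> y \<noteq> c" for y :: bit
    by (cases y; cases c; simp)
  have "bij_betw (\<lambda>x. x + t) {x \<in> S. f x = c} {x \<in> S. f x \<noteq> c}"
    by (rule bij_betwI[where g = "\<lambda>x. x + t"])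
      (use S in \<open>simp_all add: add.assoc f flip\<close>)
  then have "card {x \<in> S. f x = c} = card {x \<in> S. f x \<noteq> c}"
    by (rule bij_betw_same_card)
  moreover have "card S = card {x \<in> S. f x = c} + card {x \<in> S. f x \<noteq> c}"
    by (subst card_Un_disjoint[symmetric]) (auto intro!: arg_cong[where f = card])
  ultimately show ?thesis by simp
qed

primrec indep :: "'v list \<Rightarrow> bool" where
  "indep [] \<longleftrightarrow> True"
| "indep (r # rs) \<longleftrightarrow> r \<notin> subset_sums rs \<and> indep rs"

lemma card_perp: "indep rs \<Longrightarrow> card (perp rs) * 2 ^ length rs = 256"
proof (induction rs)
  case Nil
  then show ?case by (simp add: perp_Nil card_UNIV)
next
  case (Cons r rs)
  then obtain t where t: "t \<in> perp rs" "bf t r = 1"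
    using double_perp[of rs r] by (metis bit_not_zero_iff indep.simps(2))
  have "2 * card {x \<in> perp rs. bf x r = 0} = card (perp rs)"
    by (rule card_flip[where t = t]) (auto simp: perp_add t bf_add)
  then show ?case
    using Cons by (simp add: perp_Cons flip: Cons.IH)
qed

definition Q :: "'v set" where
  "Q = {x. q x = 1}"

text \<open>Translation by \<open>r\<close> preserves \<open>perp rs\<close>, and it changes
  \<open>q\<close> by \<open>q r = 1\<close> because the mixed term vanishes. So exactly half of
  \<open>perp rs\<close> lies in \<open>Q\<close>.\<close>

lemma card_perp_Q:
  assumes "indep rs" "r \<in> set rs" "set rs \<subseteq> Q" "\<And>x y. x \<in> set rs \<Longrightarrow> y \<in> set rs \<Longrightarrow> bf x y = 0"
  shows "card (perp rs \<inter> Q) * 2 ^ Suc (length rs) = 256"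
proof -
  have r: "q r = 1" "r \<in> perp rs"
    using assms by (auto simp: Q_def perp_def)
  have "2 * card {x \<in> perp rs. q x = 1} = card (perp rs)"
  proof (rule card_flip[where t = r])
    show "q (x + r) = q x + 1" if "x \<in> perp rs" for x
      using that r assms(2) by (simp add: q_add perp_def)
  qed (simp add: perp_add r)
  moreover have "{x \<in> perp rs. q x = 1} = perp rs \<inter> Q"
    by (auto simp: Q_def)
  ultimately show ?thesis
    using card_perp[OF assms(1)] by (metis mult.commute mult.left_commute power_Suc)
qed

lemma zero_notin_Q [simp]: "0 \<notin> Q"
  by (simp add: Q_def)

section \<open>Bases as affine subspaces\<close>

definition orth :: "'v set \<Rightarrow> bool" where
  "orth F \<longleftrightarrow> F \<subseteq> Q \<and> (\<forall>x\<in>F. \<forall>y\<in>F. bf x y = 0)"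

text \<open>On mutually orthogonal vectors \<open>q\<close> is additive, and 1 + 1 + 1 = 1. Sums of
  two such vectors, in contrast, leave \<open>Q\<close>; both facts together make bases affine
  subspaces that miss 0.\<close>

lemma orth_sum3: "orth F \<Longrightarrow> x \<in> F \<Longrightarrow> y \<in> F \<Longrightarrow> z \<in> F \<Longrightarrow> x + y + z \<in> Q"
  by (auto simp: orth_def Q_def q_add bf_add subset_iff)

definition V_bases :: "'v set set" where
  "V_bases = {B. orth B \<and> card B = 8}"

text \<open>In characteristic 2 this is the affine span of the four vectors.\<close>

definition frame :: "'v \<Rightarrow> 'v \<Rightarrow> 'v \<Rightarrow> 'v \<Rightarrow> 'v set" where
  "frame a b c d = {a, b, c, d, a + b + c, a + b + d, a + c + d, b + c + d}"

lemma vec_sum_zero [simp]: "x + y = 0 \<longleftrightarrow> x = (y::'v)"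
  by (metis vec_eq_iff_add)

lemma vec_move: "y = x + (y + z) \<longleftrightarrow> x = (z::'v)" "y = x + (z + y) \<longleftrightarrow> x = (z::'v)"
  by (metis add.commute add.left_commute vec_left_cancel)+

lemma vec_swap: "c = a + (b + d) \<longleftrightarrow> d = b + (a + (c::'v))"
  by (metis vec_left_cancel)

lemma distinct_frame:
  fixes a b c d :: 'v
  assumes "a \<noteq> b" "a \<noteq> c" "b \<noteq> c" "d \<notin> {a, b, c, a + b + c}"
  shows "distinct [a, b, c, d, a + b + c, a + b + d, a + c + d, b + c + d]"
proof -
  have "c \<noteq> a + (b + d)" "b \<noteq> a + (c + d)" "a \<noteq> b + (c + d)"
    using assms vec_swap[of c a b d] vec_swap[of b a c d] vec_swap[of a b c d] by (auto simp: ac_simps)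
  then show ?thesis
    using assms by (auto simp: ac_simps vec_move)
qed

lemma card_frame:
  assumes "a \<noteq> b" "a \<noteq> c" "b \<noteq> c" "d \<notin> {a, b, c, a + b + c}"
  shows "card (frame a b c d) = 8"
  using distinct_card[OF distinct_frame[OF assms]] by (simp add: frame_def)

text \<open>A function of degree 2 sums to 0 over an affine space of dimension 3: in the bilinear
  expansion each term such as \<open>bf a (T a)\<close> occurs four times and each mixed term such
  as \<open>bf a (T b)\<close> twice.\<close>

lemma sum_frame:
  fixes T :: "'v \<Rightarrow> 'v"
  assumes "a \<noteq> b" "a \<noteq> c" "b \<noteq> c" "d \<notin> {a, b, c, a + b + c}" and T: "\<And>x y. T (x + y) = T x + T y"
  shows "(\<Sum>x\<in>frame a b c d. bf x (T x)) = 0"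
proof -
  have "(\<Sum>x\<in>frame a b c d. bf x (T x)) =
    sum_list (map (\<lambda>x. bf x (T x)) [a, b, c, d, a + b + c, a + b + d, a + c + d, b + c + d])"
    unfolding frame_def using sum.distinct_set_conv_list[OF distinct_frame[OF assms(1-4)]] by simp
  also have "\<dots> = 0"
    by (simp only: list.map sum_list.Cons sum_list.Nil T bf_add bf_add_right add.assoc add.left_commute add.commute bit_self bit_left_cancel add_0_right)
  finally show ?thesis .
qed

lemma orth_sum2: "orth F \<Longrightarrow> x \<in> F \<Longrightarrow> y \<in> F \<Longrightarrow> x + y \<notin> Q"
  by (auto simp: orth_def Q_def q_add subset_iff)

lemma orth_sum2_neq: "orth F \<Longrightarrow> x \<in> F \<Longrightarrow> y \<in> F \<Longrightarrow> z \<in> F \<Longrightarrow> x + y \<noteq> z"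
  using orth_sum2[of F x y] by (auto simp: orth_def)

lemma orth_subset: "orth F \<Longrightarrow> G \<subseteq> F \<Longrightarrow> orth G"
  by (auto simp: orth_def)

lemma orth_nonzero: "orth F \<Longrightarrow> x \<in> F \<Longrightarrow> x \<noteq> 0"
  by (auto simp: orth_def)

lemma indep3:
  assumes o: "orth {a, b, c}" and "a \<noteq> b" "a \<noteq> c" "b \<noteq> c"
  shows "indep [a, b, c]" "indep [a, b]" "indep [a]"
proof -
  have "a \<noteq> 0" "b \<noteq> 0" "c \<noteq> 0" "a \<noteq> b + c"
    using orth_nonzero[OF o] orth_sum2_neq[OF o, of b c a] by auto
  then show "indep [a, b, c]" "indep [a, b]" "indep [a]"
    using assms(2-) by auto
qed

lemma indep4:
  assumes o: "orth {a, b, c, d}" and d: "a \<noteq> b" "a \<noteq> c" "b \<noteq> c" "d \<notin> {a, b, c, a + b + c}"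
  shows "indep [d, a, b, c]"
proof -
  have "orth {a, b, c}" using o by (rule orth_subset) auto
  then have "indep [a, b, c]" using d by (intro indep3) auto
  moreover have "d \<noteq> 0" "d \<noteq> a + b" "d \<noteq> a + c" "d \<noteq> b + c"
    using orth_nonzero[OF o, of d] orth_sum2_neq[OF o, of a b d] orth_sum2_neq[OF o, of a c d]
      orth_sum2_neq[OF o, of b c d] by auto
  then have "d \<notin> subset_sums [a, b, c]"
    using d by (auto simp: add.assoc)
  ultimately show ?thesis by simp
qed

lemma orthD: "orth F \<Longrightarrow> x \<in> F \<Longrightarrow> y \<in> F \<Longrightarrow> bf x y = 0" "orth F \<Longrightarrow> x \<in> F \<Longrightarrow> x \<in> Q"
  by (auto simp: orth_def)

lemma card_perp_orth:
  assumes "orth (set rs)" "indep rs" "rs \<noteq> []"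
  shows "card (perp rs \<inter> Q) * 2 ^ Suc (length rs) = 256"
  using assms by (intro card_perp_Q[where r = "hd rs"]) (auto simp: orth_def)

text \<open>The left side has \<open>256 / 2^5 = 8\<close> elements, and the frame supplies eight of
  them. Hence four independent members determine a basis.\<close>

lemma perp_eq_frame:
  assumes o: "orth {a, b, c, d}" and d: "a \<noteq> b" "a \<noteq> c" "b \<noteq> c" "d \<notin> {a, b, c, a + b + c}"
  shows "perp [d, a, b, c] \<inter> Q = frame a b c d"
proof -
  have "orth (set [d, a, b, c])" using o by (rule orth_subset) auto
  then have "card (perp [d, a, b, c] \<inter> Q) = 8"
    using card_perp_orth[of "[d, a, b, c]"] indep4[OF assms] by simp
  moreover have "frame a b c d \<subseteq> perp [d, a, b, c] \<inter> Q"
    using orthD[OF o] orth_sum3[OF o] by (simp add: frame_def perp_def bf_add)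
  ultimately show ?thesis
    using card_frame[OF d] by (metis card_subset_eq finite)
qed

lemma frame_in_V_bases:
  assumes o: "orth {a, b, c, d}" and d: "a \<noteq> b" "a \<noteq> c" "b \<noteq> c" "d \<notin> {a, b, c, a + b + c}"
  shows "frame a b c d \<in> V_bases"
proof -
  have "frame a b c d \<subseteq> Q"
    unfolding perp_eq_frame[OF assms, symmetric] by (rule Int_lower2)
  moreover have "\<forall>x\<in>frame a b c d. \<forall>y\<in>frame a b c d. bf x y = 0"
  proof -
    have z: "bf a b = 0" "bf a c = 0" "bf a d = 0" "bf b c = 0" "bf b d = 0" "bf c d = 0"
      by (rule orthD(1)[OF o]; simp)+
    then have "bf b a = 0" "bf c a = 0" "bf d a = 0" "bf c b = 0" "bf d b = 0" "bf d c = 0"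
      using bf_commute by metis+
    with z show ?thesis
      by (simp add: frame_def bf_add bf_add_right)
  qed
  ultimately show ?thesis
    using card_frame[OF d] by (simp add: V_bases_def orth_def)
qed

lemma V_basis_eq_frame:
  assumes B: "B \<in> V_bases" and abcd: "{a, b, c, d} \<subseteq> B" and d: "a \<noteq> b" "a \<noteq> c" "b \<noteq> c" "d \<notin> {a, b, c, a + b + c}"
  shows "B = frame a b c d"
proof -
  have oB: "orth B" and cB: "card B = 8" using B by (auto simp: V_bases_def)
  have o: "orth {a, b, c, d}" using oB abcd by (rule orth_subset)
  have "B \<subseteq> perp [d, a, b, c] \<inter> Q"
    using orthD[OF oB] abcd by (auto simp: perp_def)
  then show ?thesis
    using perp_eq_frame[OF o d] card_frame[OF d] cB by (metis card_subset_eq finite)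
qed

lemma V_basis_fourth:
  assumes B: "B \<in> V_bases" and "{a, b, c} \<subseteq> B" "a \<noteq> b" "a \<noteq> c" "b \<noteq> c"
  obtains d where "d \<notin> {a, b, c, a + b + c}" "B = frame a b c d"
proof -
  have "card {a, b, c, a + b + c} < card B"
    using B card_length[of "[a, b, c, a + b + c]"] by (simp add: V_bases_def)
  then obtain d where "d \<in> B" "d \<notin> {a, b, c, a + b + c}"
    by (metis card_mono finite leD subsetI)
  with that V_basis_eq_frame[OF B, of a b c d] assms show ?thesis by blast
qed

section \<open>Counting the bases\<close>

definition bases_above :: "'v set \<Rightarrow> 'v set set" where
  "bases_above F = {B \<in> V_bases. F \<subseteq> B}"

text \<open>Both sides count the pairs of a basis \<open>B\<close> above \<open>F\<close> and an
  element of \<open>B \<inter> D\<close>. With \<open>D\<close> the remaining candidates for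
  membership, this reduces a count above \<open>F\<close> to counts above one more vector.\<close>

lemma bases_above_double_count:
  assumes "\<And>B. B \<in> bases_above F \<Longrightarrow> card (B \<inter> D) = m"
    and "\<And>x. x \<in> D \<Longrightarrow> card (bases_above (insert x F)) = n"
  shows "m * card (bases_above F) = n * card D"
proof -
  have "(\<Sum>B\<in>bases_above F. card {x \<in> D. x \<in> B}) = n * card D"
  proof (rule sum_multicount)
    have "{B \<in> bases_above F. x \<in> B} = bases_above (insert x F)" for x
      by (auto simp: bases_above_def)
    then show "\<forall>x\<in>D. card {B \<in> bases_above F. x \<in> B} = n"
      using assms(2) by simp
  qed auto
  moreover have "{x \<in> D. x \<in> B} = B \<inter> D" for B by auto
  ultimately show ?thesis using assms(1) by (simp add: mult.commute)
qed

text \<open>Of the 16 vectors of \<open>Q\<close> orthogonal to \<open>a\<close>, \<open>b\<close>,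
  \<open>c\<close>, the four in the affine plane through them lie in every basis above. Each of the
  other 12 determines the basis, and a basis contains four of those.\<close>

lemma card_bases_above3:
  assumes o: "orth {a, b, c}" and d: "a \<noteq> b" "a \<noteq> c" "b \<noteq> c"
  shows "card (bases_above {a, b, c}) = 3"
proof -
  let ?E = "{a, b, c, a + b + c}"
  have E: "card ?E = 4" "a + b + c \<in> Q"
    using d orth_sum3[OF o] by (auto simp: card_insert_if ac_simps vec_move)
  have P: "card (perp [a, b, c] \<inter> Q) = 16"
    using card_perp_orth[of "[a, b, c]"] o indep3[OF o d] by simp
  have sub: "?E \<subseteq> perp [a, b, c] \<inter> Q"
    using orthD[OF o] E by (simp add: perp_def bf_add)
  have "4 * card (bases_above {a, b, c}) = 1 * card (perp [a, b, c] \<inter> Q - ?E)"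
  proof (rule bases_above_double_count)
    fix B assume "B \<in> bases_above {a, b, c}"
    then have B: "B \<in> V_bases" "{a, b, c} \<subseteq> B" by (auto simp: bases_above_def)
    then obtain d where "B = frame a b c d" using d V_basis_fourth by metis
    then have EB: "?E \<subseteq> B" by (auto simp: frame_def)
    have "B \<subseteq> perp [a, b, c] \<inter> Q"
      using B by (auto simp: V_bases_def perp_def orth_def)
    then have "B \<inter> (perp [a, b, c] \<inter> Q - ?E) = B - ?E" by auto
    then show "card (B \<inter> (perp [a, b, c] \<inter> Q - ?E)) = 4"
      using EB E B by (simp add: card_Diff_subset V_bases_def)
  next
    fix x assume x: "x \<in> perp [a, b, c] \<inter> Q - ?E"
    then have ox: "orth {a, b, c, x}"
      using o by (auto simp: orth_def perp_def bf_commute)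
    have nx: "x \<notin> {a, b, c, a + b + c}" using x by blast
    have "{a, b, c, x} \<subseteq> frame a b c x" by (simp add: frame_def)
    then have "frame a b c x \<in> bases_above {a, b, c, x}"
      using frame_in_V_bases[OF ox d nx] by (simp add: bases_above_def)
    moreover have "B = frame a b c x" if "B \<in> bases_above {a, b, c, x}" for B
      using that V_basis_eq_frame[of B a b c x] d nx by (simp add: bases_above_def)
    ultimately have "bases_above {a, b, c, x} = {frame a b c x}" by blast
    then show "card (bases_above (insert x {a, b, c})) = 1"
      by (simp add: insert_commute)
  qed
  then show ?thesis using P sub E by (simp add: card_Diff_subset)
qed

lemma card_bases_above2:
  assumes o: "orth {a, b}" and d: "a \<noteq> b"
  shows "card (bases_above {a, b}) = 15"
proof -
  have P: "card (perp [a, b] \<inter> Q) = 32"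
    using card_perp_orth[of "[a, b]"] o d orth_nonzero[OF o] by auto
  have sub: "{a, b} \<subseteq> perp [a, b] \<inter> Q"
    using orthD[OF o] by (simp add: perp_def)
  have "6 * card (bases_above {a, b}) = 3 * card (perp [a, b] \<inter> Q - {a, b})"
  proof (rule bases_above_double_count)
    fix B assume "B \<in> bases_above {a, b}"
    then have B: "B \<in> V_bases" "{a, b} \<subseteq> B" by (auto simp: bases_above_def)
    then have "B \<subseteq> perp [a, b] \<inter> Q"
      by (auto simp: V_bases_def perp_def orth_def)
    then have "B \<inter> (perp [a, b] \<inter> Q - {a, b}) = B - {a, b}" by auto
    then show "card (B \<inter> (perp [a, b] \<inter> Q - {a, b})) = 6"
      using B d by (simp add: card_Diff_subset V_bases_def)
  next
    fix x assume x: "x \<in> perp [a, b] \<inter> Q - {a, b}"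
    then have "orth {x, a, b}"
      using o by (auto simp: orth_def perp_def bf_commute)
    then show "card (bases_above (insert x {a, b})) = 3"
      using x d by (intro card_bases_above3) auto
  qed
  then show ?thesis using P sub d by (simp add: card_Diff_subset)
qed

lemma card_bases_above1:
  assumes a: "a \<in> Q"
  shows "card (bases_above {a}) = 135"
proof -
  have o: "orth {a}" using a by (simp add: orth_def)
  have P: "card (perp [a] \<inter> Q) = 64"
    using card_perp_orth[of "[a]"] o orth_nonzero[OF o] by auto
  have "7 * card (bases_above {a}) = 15 * card (perp [a] \<inter> Q - {a})"
  proof (rule bases_above_double_count)
    fix B assume "B \<in> bases_above {a}"
    then have B: "B \<in> V_bases" "a \<in> B" by (auto simp: bases_above_def)
    then have "B \<subseteq> perp [a] \<inter> Q"
      by (auto simp: V_bases_def perp_def orth_def)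
    then have "B \<inter> (perp [a] \<inter> Q - {a}) = B - {a}" by auto
    then show "card (B \<inter> (perp [a] \<inter> Q - {a})) = 7"
      using B by (simp add: card_Diff_subset V_bases_def)
  next
    fix x assume x: "x \<in> perp [a] \<inter> Q - {a}"
    then have "orth {x, a}"
      using o by (auto simp: orth_def perp_def bf_commute)
    then show "card (bases_above (insert x {a})) = 15"
      using x by (intro card_bases_above2) auto
  qed
  then show ?thesis using P a by (simp add: card_Diff_subset perp_def)
qed

lemma card_Q: "card Q = 120"
  using card_singular_compl by (simp add: Q_def)

lemma card_V_bases: "card V_bases = 2025"
proof -
  have "8 * card (bases_above {}) = 135 * card Q"
  proof (rule bases_above_double_count)
    fix B assume "B \<in> bases_above {}"
    then have "B \<subseteq> Q" "card B = 8" by (auto simp: bases_above_def V_bases_def orth_def)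
    then show "card (B \<inter> Q) = 8" by (simp add: Int_absorb2)
  qed (simp add: card_bases_above1)
  then show ?thesis by (simp add: card_Q bases_above_def)
qed

end

section \<open>Orbits and subset sums\<close>

text \<open>Non-negative iterates only; at a periodic point they already form the whole orbit of the
  cyclic group.\<close>

definition forward_orbit :: "('a \<Rightarrow> 'a) \<Rightarrow> 'a \<Rightarrow> 'a set" where
  "forward_orbit f x = range (\<lambda>k. (f ^^ k) x)"

lemma funpow_in_forward_orbit: "(f ^^ k) x \<in> forward_orbit f x"
  by (simp add: forward_orbit_def)

lemma forward_orbit_self: "x \<in> forward_orbit f x"
  unfolding forward_orbit_def by (metis funpow_0 rangeI)

lemma forward_orbit_finite_range:
  assumes "(f ^^ n) x = x" "n > 0"
  shows "forward_orbit f x = (\<lambda>k. (f ^^ k) x) ` {..<n}"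
  unfolding forward_orbit_def using funpow_mod_eq[OF assms(1)] assms(2)
  by (auto simp: image_iff) (metis lessThan_iff mod_less_divisor)

lemma forward_orbit_subset: "y \<in> forward_orbit f x \<Longrightarrow> forward_orbit f y \<subseteq> forward_orbit f x"
  by (auto simp: forward_orbit_def simp flip: funpow_add comp_apply[of "_ ^^ _" "_ ^^ _"])

lemma funpow_inverse: "(f ^^ n) x = x \<Longrightarrow> k \<le> n \<Longrightarrow> (f ^^ (n - k)) ((f ^^ k) x) = x"
  by (simp flip: funpow_add comp_apply[of "_ ^^ _" "_ ^^ _"])

lemma forward_orbit_eq:
  assumes "(f ^^ n) x = x" "n > 0" "y \<in> forward_orbit f x"
  shows "forward_orbit f y = forward_orbit f x"
proof
  obtain k where "k < n" "y = (f ^^ k) x"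
    using assms by (auto simp: forward_orbit_finite_range)
  then have "x \<in> forward_orbit f y"
    using funpow_inverse[OF assms(1), of k] unfolding forward_orbit_def by (metis less_imp_le rangeI)
  then show "forward_orbit f x \<subseteq> forward_orbit f y" by (rule forward_orbit_subset)
qed (rule forward_orbit_subset[OF assms(3)])

lemma card_forward_orbit:
  assumes "(f ^^ n) x = x" "n > 0" and free: "\<And>k. 0 < k \<Longrightarrow> k < n \<Longrightarrow> (f ^^ k) x \<noteq> x"
  shows "inj_on (\<lambda>k. (f ^^ k) x) {..<n}" "card (forward_orbit f x) = n"
proof -
  show inj: "inj_on (\<lambda>k. (f ^^ k) x) {..<n}"
  proof (rule linorder_inj_onI)
    fix i j assume ij: "i < j" "i \<in> {..<n}" "j \<in> {..<n}"
    show "(f ^^ i) x \<noteq> (f ^^ j) x"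
    proof
      assume eq: "(f ^^ i) x = (f ^^ j) x"
      have "(f ^^ (n - j + i)) x = (f ^^ (n - j)) ((f ^^ j) x)"
        by (simp add: funpow_add eq)
      also have "\<dots> = x" using ij by (intro funpow_inverse assms) auto
      finally show False using free[of "n - j + i"] ij by (simp del: add_diff_assoc2) linarith
    qed
  qed auto
  show "card (forward_orbit f x) = n"
    using card_image[OF inj] by (simp add: forward_orbit_finite_range[OF assms(1,2)])
qed

lemma card_forward_orbit_image:
  assumes "finite E" "\<And>x. x \<in> E \<Longrightarrow> f x \<in> E" "\<And>x. x \<in> E \<Longrightarrow> (f ^^ n) x = x" "n > 0"
    and "\<And>x k. x \<in> E \<Longrightarrow> 0 < k \<Longrightarrow> k < n \<Longrightarrow> (f ^^ k) x \<noteq> x"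
  shows "n * card (forward_orbit f ` E) = card E"
proof -
  have "forward_orbit f x \<subseteq> E" if "x \<in> E" for x
  proof -
    have "(f ^^ k) x \<in> E" for k using that assms(2) by (induction k) auto
    then show ?thesis by (auto simp: forward_orbit_def)
  qed
  then have "\<Union> (forward_orbit f ` E) = E" using forward_orbit_self by fast
  moreover have "c \<inter> d = {}" if "c \<in> forward_orbit f ` E" "d \<in> forward_orbit f ` E" "c \<noteq> d" for c d
    using that forward_orbit_eq[OF assms(3,4)] by blast
  moreover have "card c = n" if "c \<in> forward_orbit f ` E" for c
    using that assms(3-5) card_forward_orbit(2) by (metis imageE)
  ultimately show ?thesis
    using card_partition[of "forward_orbit f ` E" n] assms(1) by simp
qed

lemma invariant_sets_eq:
  assumes fE: "\<And>x. x \<in> E \<Longrightarrow> f x \<in> E" and per: "\<And>x. x \<in> E \<Longrightarrow> (f ^^ n) x = x" and n: "n > 0"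
  shows "{X. X \<subseteq> E \<and> f ` X = X} = Union ` Pow (forward_orbit f ` E)"
proof (intro equalityI subsetI)
  fix X assume "X \<in> {X. X \<subseteq> E \<and> f ` X = X}"
  then have X: "X \<subseteq> E" "f ` X = X" by auto
  have "(f ^^ k) x \<in> X" if "x \<in> X" for x k
    using that X(2) by (induction k) auto
  then have "forward_orbit f x \<subseteq> X" if "x \<in> X" for x
    using that by (auto simp: forward_orbit_def)
  then have "\<Union> (forward_orbit f ` X) \<subseteq> X" by (rule UN_least)
  moreover have "x \<in> \<Union> (forward_orbit f ` X)" if "x \<in> X" for x
    by (rule UN_I[OF that forward_orbit_self])
  ultimately have "\<Union> (forward_orbit f ` X) = X" by (rule equalityI[OF _ subsetI])
  moreover have "forward_orbit f ` X \<in> Pow (forward_orbit f ` E)" using X(1) by (simp add: image_mono)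
  ultimately show "X \<in> Union ` Pow (forward_orbit f ` E)" by (metis imageI)
next
  fix X assume "X \<in> Union ` Pow (forward_orbit f ` E)"
  then obtain A where A: "A \<subseteq> E" "X = (\<Union>x\<in>A. forward_orbit f x)"
    by (auto simp: subset_image_iff)
  have pow: "(f ^^ k) x \<in> E" if "x \<in> E" for x k
    using that fE by (induction k) auto
  have f: "f ` forward_orbit f x = forward_orbit f x" if "x \<in> E" for x
  proof
    show "f ` forward_orbit f x \<subseteq> forward_orbit f x"
    proof (rule image_subsetI)
      fix y assume "y \<in> forward_orbit f x"
      then obtain k where "y = (f ^^ k) x" by (auto simp: forward_orbit_def)
      then show "f y \<in> forward_orbit f x" using funpow_in_forward_orbit[of "Suc k" f x] by simp
    qed
    show "forward_orbit f x \<subseteq> f ` forward_orbit f x"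
    proof
      fix y assume "y \<in> forward_orbit f x"
      then obtain k where y: "y = (f ^^ k) x" by (auto simp: forward_orbit_def)
      have "y = (f ^^ (k + n)) x" by (simp add: funpow_add per[OF that] y)
      also have "\<dots> = f ((f ^^ (k + n - 1)) x)"
        using n by (cases n) auto
      finally show "y \<in> f ` forward_orbit f x" using funpow_in_forward_orbit by (rule image_eqI)
    qed
  qed
  have "forward_orbit f x \<subseteq> E" if "x \<in> E" for x using pow[OF that] by (auto simp: forward_orbit_def)
  then have "X \<subseteq> E" using A by blast
  moreover have "f ` X = (\<Union>x\<in>A. f ` forward_orbit f x)" by (simp add: A(2) image_UN)
  then have "f ` X = X" using A f by (simp add: subset_iff)
  ultimately show "X \<in> {X. X \<subseteq> E \<and> f ` X = X}" by simp
qed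

lemma inj_on_Union_disjoint:
  assumes "disjoint \<Omega>" "{} \<notin> \<Omega>"
  shows "inj_on Union (Pow \<Omega>)"
proof (rule inj_onI)
  have *: "Y \<subseteq> Z" if "Y \<subseteq> \<Omega>" "Z \<subseteq> \<Omega>" "\<Union> Y \<subseteq> \<Union> Z" for Y Z
  proof
    fix c assume "c \<in> Y"
    with that assms(2) have "c \<noteq> {}" by auto
    then obtain x where "x \<in> c" by auto
    with \<open>c \<in> Y\<close> that have "x \<in> \<Union> Z" by auto
    then obtain d where d: "x \<in> d" "d \<in> Z" by blast
    then have "c = d" using assms(1) \<open>c \<in> Y\<close> \<open>x \<in> c\<close> that by (auto simp: disjoint_def)
    with d show "c \<in> Z" by simp
  qed
  fix Y Z assume "Y \<in> Pow \<Omega>" "Z \<in> Pow \<Omega>" "\<Union> Y = \<Union> Z"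
  then show "Y = Z" using *[of Y Z] *[of Z Y] by auto
qed

text \<open>Taking symmetric differences turns the subset sums into a group homomorphism, so all fibres
  have the same size.\<close>

lemma sum_sym_diff:
  fixes w :: "'a \<Rightarrow> 'g::ab_group_add"
  assumes "finite A" "finite B" "\<And>x::'g. x + x = 0"
  shows "sum w (sym_diff A B) = sum w A + sum w B"
proof -
  have "sum w A = sum w (A - B) + sum w (A \<inter> B)" "sum w B = sum w (B - A) + sum w (A \<inter> B)"
    using assms(1,2) sum.Int_Diff[of A w B] sum.Int_Diff[of B w A] by (simp_all add: Int_commute add.commute)
  moreover have "sum w (sym_diff A B) = sum w (A - B) + sum w (B - A)"
    using assms by (intro sum.union_disjoint) auto
  ultimately show ?thesis
    by (simp add: assms(3) ac_simps)
qed

lemma card_subset_sum_fibre: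
  fixes w :: "'a \<Rightarrow> 'g::{finite,ab_group_add}"
  assumes fin: "finite \<Omega>" and self: "\<And>x::'g. x + x = 0"
    and surj: "\<And>c. \<exists>Y\<subseteq>\<Omega>. sum w Y = c"
  shows "card {Y. Y \<subseteq> \<Omega> \<and> sum w Y = c} * CARD('g) = 2 ^ card \<Omega>"
proof -
  let ?F = "\<lambda>c. {Y. Y \<subseteq> \<Omega> \<and> sum w Y = c}"
  have le: "card (?F d) \<le> card (?F e)" for d e
  proof -
    \<comment> \<open>Symmetric difference with a set of sum \<open>d + e\<close> maps the fibre
      over \<open>d\<close> injectively into the fibre over \<open>e\<close>.\<close>
    obtain Z where Z: "Z \<subseteq> \<Omega>" "sum w Z = d + e" using surj by blast
    have "inj_on (\<lambda>Y. sym_diff Y Z) (?F d)"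
      by (rule inj_onI) blast
    moreover have "(\<lambda>Y. sym_diff Y Z) ` ?F d \<subseteq> ?F e"
    proof safe
      fix Y assume Y: "Y \<subseteq> \<Omega>" "d = sum w Y"
      then have "sum w (sym_diff Y Z) = sum w Y + sum w Z"
        using fin Z by (intro sum_sym_diff self) (auto intro: finite_subset)
      then show "sum w (sym_diff Y Z) = e"
        using Z Y by (simp add: self flip: add.assoc)
    qed (use Z in auto)
    moreover have "finite (?F e)" using fin by simp
    ultimately show ?thesis by (rule card_inj_on_le)
  qed
  have eq: "card (?F d) = card (?F c)" for d
    using le[of c d] le[of d c] by simp
  have "card (Pow \<Omega>) = (\<Sum>d\<in>UNIV. card (?F d))"
    using fin by (subst card_UN_disjoint[symmetric]) (auto intro!: arg_cong[where f = card])
  also have "\<dots> = (\<Sum>d\<in>(UNIV::'g set). card (?F c))"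
    by (rule sum.cong[OF refl eq])
  finally show ?thesis by (simp add: card_Pow fin mult.commute)
qed

section \<open>A cyclic group of order 15 acting freely on vectors and bases\<close>

locale cyclic_quadratic_space = quadratic_space q bf
  for q :: "'v::{finite,ab_group_add} \<Rightarrow> bit" and bf +
  fixes s :: "'v \<Rightarrow> 'v"
  assumes s_add: "s (x + y) = s x + s y"
    and q_s: "q (s x) = q x"
    and s_15: "(s ^^ 15) x = x"
    and s_5: "x + (s ^^ 5) x + (s ^^ 10) x = 0"
    and s_3: "x + (s ^^ 3) x + (s ^^ 6) x + (s ^^ 9) x + (s ^^ 12) x = 0"
begin

definition invariants :: "'v \<Rightarrow> bit \<times> bit \<times> bit" where
  "invariants x = (bf x (s x), bf x (s (s x)), bf x (s (s (s x))))"

lemma bf_s: "bf (s x) (s y) = bf x y"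
  using q_add[of x y] q_add[of "s x" "s y"] by (simp add: q_s flip: s_add)

lemma invariants_s: "invariants (s x) = invariants x"
  by (simp add: invariants_def bf_s)

lemma invariants_s_pow: "invariants ((s ^^ k) x) = invariants x"
  by (induction k) (simp_all add: invariants_s)

lemma inj_s: "inj s"
proof (rule inj_on_inverseI)
  fix x
  have "(s ^^ 14) (s x) = (s ^^ Suc 14) x"
    by (simp only: funpow_Suc_right comp_apply)
  then show "(s ^^ 14) (s x) = x" by (simp add: s_15)
qed

lemma multiple_3_or_5:
  fixes k :: nat
  assumes "0 < k" "k < 15"
  obtains m where "(m * k) mod 15 = 3 \<or> (m * k) mod 15 = 5"
proof -
  have "k \<in> {1,2,3,4,5,6,7,8,9,10,11,12,13,14}" using assms by auto presburger
  then have "\<exists>m\<in>{1,2,3,4,5,6,7,8,9,10,11,12,13,14}. (m * k) mod 15 = 3 \<or> (m * k) mod 15 = 5"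
    by (elim insertE emptyE) simp_all
  with that show thesis by blast
qed

text \<open>The gcd of \<open>k\<close> and 15 is 1, 3 or 5, so some multiple of \<open>k\<close> is
  congruent to 3 or 5. Freeness thus needs checking only for the elements of prime order.\<close>

lemma fixed_power:
  assumes "(f ^^ 15) x = x" "(f ^^ k) x = x" "0 < k" "k < 15"
  shows "(f ^^ 3) x = x \<or> (f ^^ 5) x = x"
proof -
  obtain m where m: "(m * k) mod 15 = 3 \<or> (m * k) mod 15 = 5"
    using multiple_3_or_5 assms(3,4) by metis
  have "(f ^^ (m * k)) x = x"
    by (induction m) (simp_all add: funpow_add assms(2))
  with m show ?thesis
    using funpow_mod_eq[OF assms(1), of "m * k"] by auto
qed

text \<open>A vector fixed by the third power satisfies \<open>5 x = 0\<close> by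
  \<open>s_3\<close>, one fixed by the fifth power \<open>3 x = 0\<close> by \<open>s_5\<close>;
  since \<open>2 x = 0\<close>, either way \<open>x = 0\<close>.\<close>

lemma s_free:
  assumes "x \<noteq> 0" "0 < k" "k < 15"
  shows "(s ^^ k) x \<noteq> x"
proof
  assume "(s ^^ k) x = x"
  then consider "(s ^^ 3) x = x" | "(s ^^ 5) x = x"
    using fixed_power[OF s_15 _ assms(2,3)] by blast
  then show False
  proof cases
    case 1
    have "(s ^^ (m * 3)) x = x" for m
      by (induction m) (simp_all only: funpow_add mult_Suc comp_apply 1 mult_0 funpow_0 id_apply)
    from this[of 2] this[of 3] this[of 4] have "x + x + x + x + x = 0"
      using s_3[of x] 1 by simp
    with assms show False by simp
  next
    case 2
    have "(s ^^ (m * 5)) x = x" for m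
      by (induction m) (simp_all only: funpow_add mult_Suc comp_apply 2 mult_0 funpow_0 id_apply)
    from this[of 2] have "x + x + x = 0"
      using s_5[of x] 2 by simp
    with assms show False by simp
  qed
qed

lemma image_s_pow: "((`) s ^^ k) B = (s ^^ k) ` B"
  by (induction k) (simp_all add: image_comp)

lemma image_s_15: "((`) s ^^ 15) B = B"
  unfolding image_s_pow by (simp add: s_15)

lemma image_s_basis: "B \<in> V_bases \<Longrightarrow> s ` B \<in> V_bases"
  by (auto simp: V_bases_def orth_def Q_def q_s bf_s subset_iff card_image[OF inj_on_subset[OF inj_s]])

text \<open>In an invariant basis the orbit of a vector under an element of order 3 or 5 would consist of an
  odd number of mutually orthogonal vectors with \<open>q = 1\<close>, so its sum would satisfy \<open>q = 1\<close> as well;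
  but the sum is 0.\<close>

lemma image_s_free:
  assumes B: "B \<in> V_bases" and k: "0 < k" "k < 15"
  shows "((`) s ^^ k) B \<noteq> B"
proof
  assume "((`) s ^^ k) B = B"
  then consider "(s ^^ 3) ` B = B" | "(s ^^ 5) ` B = B"
    using fixed_power[OF image_s_15 _ k, of B] unfolding image_s_pow by blast
  moreover from B have o: "orth B" "card B = 8" by (auto simp: V_bases_def)
  then obtain x where x: "x \<in> B" by fastforce
  have sum0: "q (a + b + c) = 1" if "a \<in> B" "b \<in> B" "c \<in> B" for a b c
    using orth_sum3[OF o(1) that] by (simp add: Q_def)
  ultimately show False
  proof cases
    case 1
    have "(s ^^ (m * 3)) x \<in> B" for m
    proof (induction m)
      case (Suc m)
      then show ?case
        using 1 by (simp only: funpow_add mult_Suc comp_apply) blast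
    qed (use x in simp)
    from this[of 1] this[of 2] this[of 3] this[of 4]
    have m: "(s ^^ 3) x \<in> B" "(s ^^ 6) x \<in> B" "(s ^^ 9) x \<in> B" "(s ^^ 12) x \<in> B" by simp_all
    have "q (x + (s ^^ 3) x + (s ^^ 6) x + (s ^^ 9) x + (s ^^ 12) x) =
      q (x + (s ^^ 3) x + (s ^^ 6) x) + q ((s ^^ 9) x) + q ((s ^^ 12) x)"
      using orthD(1)[OF o(1)] x m by (simp add: q_add bf_add)
    also have "\<dots> = 1"
      using sum0[OF x m(1,2)] orthD(2)[OF o(1)] m by (simp add: Q_def)
    finally show False by (simp add: s_3)
  next
    case 2
    have "(s ^^ (m * 5)) x \<in> B" for m
    proof (induction m)
      case (Suc m)
      then show ?case
        using 2 by (simp only: funpow_add mult_Suc comp_apply) blast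
    qed (use x in simp)
    from this[of 1] this[of 2] have "q (x + (s ^^ 5) x + (s ^^ 10) x) = 1"
      using sum0[OF x] by simp
    then show False by (simp add: s_5)
  qed
qed

end

section \<open>Invariant parity conditions\<close>

lemma of_nat_bit: "(of_nat n :: bit) = of_bool (odd n)"
  by (induction n) auto

lemma even_iff_bit: "even n \<longleftrightarrow> (of_nat n :: bit) = 0" "odd n \<longleftrightarrow> (of_nat n :: bit) = 1"
  by (simp_all add: of_nat_bit)

lemma bit_add_eq_zero: "x + y = 0 \<longleftrightarrow> x = (y::bit)"
  by (cases x; cases y; simp)

text \<open>Self-duality of the first-order Reed-Muller code of length 8: a function on the 3-space
  that is orthogonal to 1 and to the three coordinates is itself affine, so its values at 0 and the
  three unit points determine the others.\<close>

lemma affine_relations: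
  fixes n000 n001 n010 n011 n100 n101 n110 n111 :: bit
  assumes "n000 + n001 + n010 + n011 + n100 + n101 + n110 + n111 = 0"
    and "n100 + n101 + n110 + n111 = 0" "n010 + n011 + n110 + n111 = 0" "n001 + n011 + n101 + n111 = 0"
  shows "n110 = n000 + n100 + n010" "n101 = n000 + n100 + n001" "n011 = n000 + n010 + n001"
    "n111 = n100 + n010 + n001"
proof -
  have "n110 + (n000 + n100 + n010) = (n000 + n001 + n010 + n011 + n100 + n101 + n110 + n111) + (n001 + n011 + n101 + n111)"
    by (simp add: bit_simps)
  then show "n110 = n000 + n100 + n010"
    using assms by (simp add: bit_add_eq_zero)
  have "n101 + (n000 + n100 + n001) = (n000 + n001 + n010 + n011 + n100 + n101 + n110 + n111) + (n010 + n011 + n110 + n111)"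
    by (simp add: bit_simps)
  then show "n101 = n000 + n100 + n001"
    using assms by (simp add: bit_add_eq_zero)
  have "n011 + (n000 + n010 + n001) = (n000 + n001 + n010 + n011 + n100 + n101 + n110 + n111) + (n100 + n101 + n110 + n111)"
    by (simp add: bit_simps)
  then show "n011 = n000 + n010 + n001"
    using assms by (simp add: bit_add_eq_zero)
  have "n111 + (n100 + n010 + n001) = (n100 + n101 + n110 + n111) + (n010 + n011 + n110 + n111) + (n001 + n011 + n101 + n111)"
    by (simp add: bit_simps)
  then show "n111 = n100 + n010 + n001"
    using assms by (simp add: bit_add_eq_zero)
qed

lemma sum_Pair: "(\<Sum>x\<in>A. (f x, g x)) = (sum f A, sum g A)"
  by (simp add: prod_eq_iff fst_sum snd_sum)

lemma sum_bit3:
  fixes f :: "bit \<times> bit \<times> bit \<Rightarrow> 'a::comm_monoid_add"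
  shows "(\<Sum>p\<in>UNIV. f p) = f (0,0,0) + f (0,0,1) + f (0,1,0) + f (0,1,1) +
    f (1,0,0) + f (1,0,1) + f (1,1,0) + f (1,1,1)"
proof -
  have "sum f UNIV = sum f ({0, 1} \<times> {0, 1} \<times> {0, 1})"
    by (simp only: UNIV_bit flip: UNIV_Times_UNIV)
  then show ?thesis
    by (simp add: sum.cartesian_product' ac_simps)
qed

context cyclic_quadratic_space
begin

definition profile :: "bit \<times> bit \<times> bit \<Rightarrow> 'v set \<Rightarrow> bit" where
  "profile p B = of_nat (card {x \<in> B. invariants x = p})"

lemma sum_invariants: "(\<Sum>x\<in>B. \<phi> (invariants x)) = (\<Sum>p\<in>UNIV. profile p B * \<phi> p)"
proof -
  have "(\<Sum>x\<in>B. \<phi> (invariants x)) = (\<Sum>p\<in>UNIV. \<Sum>x\<in>{x \<in> B. invariants x = p}. \<phi> (invariants x))"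
    by (rule sum.group[symmetric]) auto
  also have "\<dots> = (\<Sum>p\<in>UNIV. profile p B * \<phi> p)"
    by (rule sum.cong) (simp_all add: profile_def)
  finally show ?thesis .
qed

text \<open>The invariants are quadratic functions and a basis is a three-dimensional affine subspace, so
  their values sum to 0. Hence the profile is an affine function.\<close>

lemma profile_affine:
  assumes B: "B \<in> V_bases"
  shows "profile (a, b, c) B = (1 + a + b + c) * profile (0,0,0) B + a * profile (1,0,0) B +
    b * profile (0,1,0) B + c * profile (0,0,1) B"
proof -
  have c8: "card B = 8" using B by (simp add: V_bases_def)
  then obtain T where "T \<subseteq> B" "card T = 3"
    using obtain_subset_with_card_n[of 3 B] by auto
  then obtain r1 r2 r3 where r: "{r1, r2, r3} \<subseteq> B" "r1 \<noteq> r2" "r1 \<noteq> r3" "r2 \<noteq> r3"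
    unfolding card_3_iff by metis
  then obtain r4 where r4: "r4 \<notin> {r1, r2, r3, r1 + r2 + r3}" "B = frame r1 r2 r3 r4"
    using V_basis_fourth[OF B] by metis
  have quad: "(\<Sum>x\<in>B. bf x (T x)) = 0" if "\<And>x y. T (x + y) = T x + T y" for T
    unfolding r4(2) using r(2-) r4(1) that by (rule sum_frame)
  have "(\<Sum>x\<in>B. fst (invariants x)) = 0"
    using quad[of s] by (simp add: invariants_def s_add)
  moreover have "(\<Sum>x\<in>B. fst (snd (invariants x))) = 0"
    using quad[of "\<lambda>x. s (s x)"] by (simp add: invariants_def s_add)
  moreover have "(\<Sum>x\<in>B. snd (snd (invariants x))) = 0"
    using quad[of "\<lambda>x. s (s (s x))"] by (simp add: invariants_def s_add)
  moreover have "(\<Sum>x\<in>B. (\<lambda>_. 1::bit) (invariants x)) = 0"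
    using c8 by simp
  ultimately have R:
    "profile (1,0,0) B + profile (1,0,1) B + profile (1,1,0) B + profile (1,1,1) B = 0"
    "profile (0,1,0) B + profile (0,1,1) B + profile (1,1,0) B + profile (1,1,1) B = 0"
    "profile (0,0,1) B + profile (0,1,1) B + profile (1,0,1) B + profile (1,1,1) B = 0"
    "profile (0,0,0) B + profile (0,0,1) B + profile (0,1,0) B + profile (0,1,1) B +
     profile (1,0,0) B + profile (1,0,1) B + profile (1,1,0) B + profile (1,1,1) B = 0"
    using sum_invariants[of fst B] sum_invariants[of "\<lambda>p. fst (snd p)" B]
      sum_invariants[of "\<lambda>p. snd (snd p)" B] sum_invariants[of "\<lambda>_. 1" B]
    unfolding sum_bit3 by simp_all
  note A = affine_relations[OF R(4,1-3)]
  show ?thesis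
    by (cases a; cases b; cases c) (simp_all only: A, simp_all add: bit_simps)
qed

abbreviation incidence :: "'v set set \<Rightarrow> 'v \<Rightarrow> bit" where
  "incidence \<omega> x \<equiv> of_nat (card {B \<in> \<omega>. x \<in> B})"

abbreviation basis_orbit :: "'v set \<Rightarrow> 'v set set" where
  "basis_orbit \<equiv> forward_orbit ((`) s)"

abbreviation basis_orbits :: "'v set set set" where
  "basis_orbits \<equiv> basis_orbit ` V_bases"

lemma card_basis_orbit: "B \<in> V_bases \<Longrightarrow> card (basis_orbit B) = 15"
  using image_s_15 image_s_free by (intro card_forward_orbit) auto

lemma card_basis_orbits: "card basis_orbits = 135"
proof -
  have "15 * card basis_orbits = card V_bases"
    using image_s_15 image_s_free image_s_basis by (intro card_forward_orbit_image) auto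
  then show ?thesis by (simp add: card_V_bases)
qed

lemma disjoint_basis_orbits: "disjoint basis_orbits"
proof (rule disjointI)
  fix c d assume cd: "c \<in> basis_orbits" "d \<in> basis_orbits" "c \<noteq> d"
  show "c \<inter> d = {}"
  proof (rule ccontr)
    assume "c \<inter> d \<noteq> {}"
    then obtain B where "B \<in> c" "B \<in> d" by blast
    then have "c = basis_orbit B" "d = basis_orbit B"
      using cd forward_orbit_eq[OF image_s_15] by auto
    with cd show False by simp
  qed
qed

text \<open>The vector \<open>x\<close> lies in the \<open>k\<close>-th translate of
  \<open>B\<close> exactly if moving \<open>x\<close> back by \<open>k\<close> steps leads into
  \<open>B\<close>. The exponents \<open>?K\<close> correspond to bases of the orbit because the
  action on bases is free, and to members of \<open>B\<close> in the orbit of \<open>x\<close>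
  because the action on vectors is free.\<close>

lemma incidence_basis_orbit:
  assumes B: "B \<in> V_bases" and x: "x \<in> Q"
    and orbit: "\<And>y. y \<in> Q \<Longrightarrow> invariants y = invariants x \<Longrightarrow> \<exists>k<15. x = (s ^^ k) y"
  shows "incidence (basis_orbit B) x = profile (invariants x) B"
proof -
  let ?K = "{k. k < 15 \<and> x \<in> (s ^^ k) ` B}"
  have b1: "bij_betw (\<lambda>k. ((`) s ^^ k) B) ?K {B' \<in> basis_orbit B. x \<in> B'}"
  proof (rule bij_betw_imageI)
    have "inj_on (\<lambda>k. ((`) s ^^ k) B) {..<15}"
      using image_s_15 image_s_free[OF B] by (intro card_forward_orbit) auto
    then show "inj_on (\<lambda>k. ((`) s ^^ k) B) ?K"
      by (rule inj_on_subset) auto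
    have "basis_orbit B = (\<lambda>k. ((`) s ^^ k) B) ` {..<15}"
      by (rule forward_orbit_finite_range) (simp_all add: image_s_15)
    then show "(\<lambda>k. ((`) s ^^ k) B) ` ?K = {B' \<in> basis_orbit B. x \<in> B'}"
      by (auto simp: image_s_pow)
  qed
  \<comment> \<open>The exponent \<open>15 - k\<close> stands for \<open>-k\<close>; at
    \<open>k = 0\<close> it is a full turn and gives \<open>x\<close> again.\<close>
  have b2: "bij_betw (\<lambda>k. (s ^^ (15 - k)) x) ?K {y \<in> B. invariants y = invariants x}"
  proof (rule bij_betw_imageI)
    show "inj_on (\<lambda>k. (s ^^ (15 - k)) x) ?K"
    proof (rule linorder_inj_onI)
      fix i j :: nat assume ij: "i < j" "i \<in> ?K" "j \<in> ?K"
      show "(s ^^ (15 - i)) x \<noteq> (s ^^ (15 - j)) x"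
      proof
        assume "(s ^^ (15 - i)) x = (s ^^ (15 - j)) x"
        then have "(s ^^ (j + (15 - i))) x = (s ^^ (j + (15 - j))) x"
          by (simp only: funpow_add comp_apply)
        moreover have "j + (15 - i) = (j - i) + 15" "j + (15 - j) = 15" using ij by auto
        ultimately have "(s ^^ (j - i)) x = x"
          by (simp only: funpow_add comp_apply s_15)
        moreover have "x \<noteq> 0" using x by auto
        moreover have "0 < j - i" "j - i < 15" using ij by auto
        ultimately show False using s_free[of x "j - i"] by blast
      qed
    qed auto
    show "(\<lambda>k. (s ^^ (15 - k)) x) ` ?K = {y \<in> B. invariants y = invariants x}"
    proof (intro equalityI subsetI)
      fix y assume "y \<in> (\<lambda>k. (s ^^ (15 - k)) x) ` ?K"
      then obtain k z where "k < 15" "z \<in> B" "x = (s ^^ k) z" "y = (s ^^ (15 - k)) x" by auto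
      then have "y = z" by (simp add: funpow_inverse[OF s_15])
      then show "y \<in> {y \<in> B. invariants y = invariants x}"
        using \<open>z \<in> B\<close> \<open>x = (s ^^ k) z\<close> by (simp add: invariants_s_pow)
    next
      fix y assume y: "y \<in> {y \<in> B. invariants y = invariants x}"
      then have "y \<in> Q" using B by (auto simp: V_bases_def orth_def)
      with y orbit obtain k where k: "k < 15" "x = (s ^^ k) y" by blast
      then have "y = (s ^^ (15 - k)) x" by (simp add: funpow_inverse[OF s_15])
      moreover have "k \<in> ?K" using k y by auto
      ultimately show "y \<in> (\<lambda>k. (s ^^ (15 - k)) x) ` ?K" by (rule image_eqI)
    qed
  qed
  have "card {B' \<in> basis_orbit B. x \<in> B'} = card {y \<in> B. invariants y = invariants x}"
    using bij_betw_same_card[OF b1] bij_betw_same_card[OF b2] by simp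
  then show ?thesis by (simp add: profile_def)
qed

text \<open>Invariant sets are unions of orbits, so the count is over subsets of the 135 orbits. The
  types of \<open>p0\<close>, ..., \<open>p3\<close> are an affine frame of the 3-space; by
  affinity, even incidence at these four vectors implies it everywhere. What remains is one fibre of
  a surjection onto five bits.\<close>

theorem card_invariant_parity_proofs:
  assumes orbit: "\<And>x y. x \<in> Q \<Longrightarrow> y \<in> Q \<Longrightarrow> invariants y = invariants x \<Longrightarrow> \<exists>k<15. x = (s ^^ k) y"
    and p: "{p0, p1, p2, p3} \<subseteq> Q" "invariants p0 = (0,0,0)" "invariants p1 = (1,0,0)"
      "invariants p2 = (0,1,0)" "invariants p3 = (0,0,1)"
    and wit: "\<And>v. v \<in> {(0,0,0,0), (1,0,0,0), (0,1,0,0), (0,0,1,0), (0,0,0,1)} \<Longrightarrow>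
      \<exists>B\<in>V_bases. (profile (0,0,0) B, profile (1,0,0) B, profile (0,1,0) B, profile (0,0,1) B) = v"
  shows "card {X. X \<subseteq> V_bases \<and> (`) s ` X = X \<and> odd (card X) \<and> (\<forall>x\<in>Q. even (card {B \<in> X. x \<in> B}))} = 2 ^ 130"
proof -
  \<comment> \<open>The constant last component counts orbits modulo 2, which is the parity of the
    number of bases since every orbit has 15 of them.\<close>
  define W :: "'v set set \<Rightarrow> bit \<times> bit \<times> bit \<times> bit \<times> bit" where
    "W = (\<lambda>\<omega>. (incidence \<omega> p0, incidence \<omega> p1, incidence \<omega> p2, incidence \<omega> p3, 1))"
  have W_orbit: "W (basis_orbit B) = (profile (0,0,0) B, profile (1,0,0) B, profile (0,1,0) B, profile (0,0,1) B, 1)"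
    if "B \<in> V_bases" for B
    using that p orbit by (simp add: W_def incidence_basis_orbit)
  have incidence: "incidence \<omega> x = (1 + a + b + c) * incidence \<omega> p0 + a * incidence \<omega> p1 +
      b * incidence \<omega> p2 + c * incidence \<omega> p3"
    if "\<omega> \<in> basis_orbits" "x \<in> Q" "invariants x = (a, b, c)" for \<omega> x a b c
  proof -
    from that(1) obtain B where B: "B \<in> V_bases" "\<omega> = basis_orbit B" by blast
    have "incidence \<omega> y = profile (invariants y) B" if "y \<in> Q" for y
      unfolding B(2) by (rule incidence_basis_orbit[OF B(1) that orbit[OF that]])
    then show ?thesis
      using that p by (simp add: profile_affine[OF B(1), of a b c])
  qed
  have sum_W: "sum W Y = (0, 0, 0, 0, 1) \<longleftrightarrow>
      odd (card (\<Union> Y)) \<and> (\<forall>x\<in>Q. even (card {B \<in> \<Union> Y. x \<in> B}))" if Y: "Y \<subseteq> basis_orbits" for Y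
  proof -
    have dis: "disjoint Y" using disjoint_basis_orbits Y by (rule pairwise_subset)
    have "card (\<Union> Y) = (\<Sum>\<omega>\<in>Y. card \<omega>)"
      by (rule card_Union_disjoint) (simp_all add: dis)
    also have "\<dots> = (\<Sum>\<omega>\<in>Y. 15)"
      using Y card_basis_orbit by (intro sum.cong) auto
    finally have "odd (card (\<Union> Y)) \<longleftrightarrow> odd (card Y)" by simp
    then have 1: "odd (card (\<Union> Y)) \<longleftrightarrow> (\<Sum>\<omega>\<in>Y. 1::bit) = 1" by (simp add: even_iff_bit)
    have inc: "incidence (\<Union> Y) x = (\<Sum>\<omega>\<in>Y. incidence \<omega> x)" for x
    proof -
      have "card {B \<in> \<Union> Y. x \<in> B} = card (\<Union>\<omega>\<in>Y. {B \<in> \<omega>. x \<in> B})"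
        by (rule arg_cong[where f = card]) auto
      also have "\<dots> = (\<Sum>\<omega>\<in>Y. card {B \<in> \<omega>. x \<in> B})"
        using dis by (intro card_UN_disjoint) (auto simp: pairwise_def disjnt_def)
      finally show ?thesis by simp
    qed
    have "(\<forall>x\<in>Q. incidence (\<Union> Y) x = 0) \<longleftrightarrow> incidence (\<Union> Y) p0 = 0 \<and> incidence (\<Union> Y) p1 = 0 \<and>
      incidence (\<Union> Y) p2 = 0 \<and> incidence (\<Union> Y) p3 = 0" (is "?L \<longleftrightarrow> ?R")
    proof
      assume R: ?R
      show ?L
      proof
        fix x assume x: "x \<in> Q"
        obtain a b c where abc: "invariants x = (a, b, c)" by (cases "invariants x")
        have "incidence (\<Union> Y) x = (\<Sum>\<omega>\<in>Y. (1 + a + b + c) * incidence \<omega> p0 + a * incidence \<omega> p1 +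
            b * incidence \<omega> p2 + c * incidence \<omega> p3)"
          unfolding inc using Y x abc by (intro sum.cong refl incidence) auto
        also have "\<dots> = (1 + a + b + c) * incidence (\<Union> Y) p0 + a * incidence (\<Union> Y) p1 +
            b * incidence (\<Union> Y) p2 + c * incidence (\<Union> Y) p3"
          unfolding inc by (simp only: sum.distrib sum_distrib_left)
        finally show "incidence (\<Union> Y) x = 0" using R by simp
      qed
    qed (use p in blast)
    moreover have "sum W Y = (incidence (\<Union> Y) p0, incidence (\<Union> Y) p1, incidence (\<Union> Y) p2,
        incidence (\<Union> Y) p3, (\<Sum>\<omega>\<in>Y. 1))"
      unfolding W_def sum_Pair inc ..
    ultimately show ?thesis
      using 1 unfolding even_iff_bit(1) by (simp only: prod.inject) blast
  qed
  have surj: "\<exists>Y\<subseteq>basis_orbits. sum W Y = c" for c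
  proof -
    define T where "T = {c. \<exists>Y\<subseteq>basis_orbits. sum W Y = c}"
    have zero: "0 \<in> T" unfolding T_def by (auto intro!: exI[of _ "{}"])
    have add: "c + d \<in> T" if cd: "c \<in> T" "d \<in> T" for c d
    proof -
      obtain Y Z where "Y \<subseteq> basis_orbits" "Z \<subseteq> basis_orbits" "sum W Y = c" "sum W Z = d"
        using cd by (auto simp: T_def)
      moreover have "x + x = 0" for x :: "bit \<times> bit \<times> bit \<times> bit \<times> bit"
        by (simp add: prod_eq_iff bit_self)
      ultimately have "sum W (sym_diff Y Z) = c + d" "sym_diff Y Z \<subseteq> basis_orbits"
        using sum_sym_diff[of Y Z W] by auto
      then show ?thesis unfolding T_def by blast
    qed
    have *: "(a, b, c, d, 1) \<in> T" if v: "(a, b, c, d) \<in> {(0,0,0,0), (1,0,0,0), (0,1,0,0), (0,0,1,0), (0,0,0,1)}" for a b c d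
    proof -
      obtain B where "B \<in> V_bases" "(profile (0,0,0) B, profile (1,0,0) B, profile (0,1,0) B, profile (0,0,1) B) = (a, b, c, d)"
        using wit[OF v] by blast
      then have "sum W {basis_orbit B} = (a, b, c, d, 1)" "{basis_orbit B} \<subseteq> basis_orbits"
        using W_orbit[of B] by simp_all
      then show ?thesis unfolding T_def by blast
    qed
    \<comment> \<open>The basis with zero profile yields the vector that records only the number of
      orbits. Adding it to the vectors of the other four witnesses clears their last component and
      leaves unit vectors.\<close>
    have e: "(0,0,0,0,1) \<in> T" by (rule *) simp
    have "(1,0,0,0,0) \<in> T" "(0,1,0,0,0) \<in> T" "(0,0,1,0,0) \<in> T" "(0,0,0,1,0) \<in> T"
      using add[OF *[of 1 0 0 0] e] add[OF *[of 0 1 0 0] e] add[OF *[of 0 0 1 0] e] add[OF *[of 0 0 0 1] e]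
      by simp_all
    then have "(a,0,0,0,0) \<in> T" "(0,a,0,0,0) \<in> T" "(0,0,a,0,0) \<in> T" "(0,0,0,a,0) \<in> T" "(0,0,0,0,a) \<in> T" for a
      using zero e by (cases a; simp add: zero_prod_def)+
    then have "(a,0,0,0,0) + (0,b,0,0,0) + (0,0,c,0,0) + (0,0,0,d,0) + (0,0,0,0,e) \<in> T" for a b c d e
      by (intro add)
    then have "(a, b, c, d, e) \<in> T" for a b c d e by simp
    then show ?thesis by (cases c) (auto simp: T_def)
  qed
  have inj: "inj_on Union (Pow basis_orbits)"
  proof (rule inj_on_Union_disjoint[OF disjoint_basis_orbits])
    show "{} \<notin> basis_orbits" using forward_orbit_self by fast
  qed
  have E: "{X. X \<subseteq> V_bases \<and> (`) s ` X = X} = Union ` Pow basis_orbits"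
    by (rule invariant_sets_eq[where n = 15]) (simp_all add: image_s_basis image_s_15)
  define good where "good X \<longleftrightarrow> odd (card X) \<and> (\<forall>x\<in>Q. even (card {B \<in> X. x \<in> B}))" for X
  have "{X. X \<subseteq> V_bases \<and> (`) s ` X = X \<and> good X} = {X \<in> {X. X \<subseteq> V_bases \<and> (`) s ` X = X}. good X}"
    by blast
  also have "\<dots> = Union ` {Y \<in> Pow basis_orbits. good (\<Union> Y)}"
    unfolding E by blast
  also have "{Y \<in> Pow basis_orbits. good (\<Union> Y)} = {Y. Y \<subseteq> basis_orbits \<and> sum W Y = (0, 0, 0, 0, 1)}"
    using sum_W by (auto simp: good_def)
  finally have "card {X. X \<subseteq> V_bases \<and> (`) s ` X = X \<and> good X} =
      card {Y. Y \<subseteq> basis_orbits \<and> sum W Y = (0, 0, 0, 0, 1)}"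
    by (simp only:) (rule card_image, rule inj_on_subset[OF inj], auto)
  moreover have "card {Y. Y \<subseteq> basis_orbits \<and> sum W Y = (0, 0, 0, 0, 1)} * CARD(bit \<times> bit \<times> bit \<times> bit \<times> bit) = 2 ^ card basis_orbits"
    by (rule card_subset_sum_fibre[OF _ _ surj]) (simp_all add: prod_eq_iff bit_self)
  ultimately show ?thesis by (simp add: card_basis_orbits good_def)
qed

end

section \<open>The count in the coordinate model\<close>

lemma vec8_self: "x + x = (0::vec8)"
  by (cases x rule: vec8_cases) (simp add: bit_self zero_prod_def)

lemma bf_nondegenerate: "(\<And>x. bf x s = 0) \<Longrightarrow> s = 0"
proof (cases s rule: vec8_cases)
  case (1 a b c d e f g h)
  assume "\<And>x. bf x s = 0"
  from this[of "(1,0,0,0,0,0,0,0)"] this[of "(0,1,0,0,0,0,0,0)"] this[of "(0,0,1,0,0,0,0,0)"] this[of "(0,0,0,1,0,0,0,0)"]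
     this[of "(0,0,0,0,1,0,0,0)"] this[of "(0,0,0,0,0,1,0,0)"] this[of "(0,0,0,0,0,0,1,0)"] this[of "(0,0,0,0,0,0,0,1)"]
  show "s = 0" unfolding 1
    by (auto simp: zero_prod_def)
qed

lemma sum_bit: "(\<Sum>a\<in>(UNIV::bit set). f a) = f 0 + f 1" for f :: "bit \<Rightarrow> 'a::comm_monoid_add"
  by (simp add: UNIV_bit)

lemma sum_UNIV_prod: "(\<Sum>x\<in>UNIV. f x) = (\<Sum>a\<in>UNIV. \<Sum>b\<in>UNIV. f (a, b))"
  for f :: "'a::finite \<times> 'b::finite \<Rightarrow> 'c::comm_monoid_add"
  by (simp add: sum.cartesian_product)

lemma card_qf: "card {x. qf x = 1} = 120"
proof -
  have "card {x. qf x = 1} = (\<Sum>x\<in>UNIV. if qf x = 1 then 1 else 0)"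
    by (simp add: sum.If_cases)
  also have "\<dots> = 120"
    by (simp only: sum_UNIV_prod sum_bit) simp
  finally show ?thesis .
qed

lemma sh_3: "x + (sh ^^ 3) x + (sh ^^ 6) x + (sh ^^ 9) x + (sh ^^ 12) x = 0"
  by (cases x rule: vec8_cases) (simp add: bit_simps eval_nat_numeral zero_prod_def)

interpretation V: cyclic_quadratic_space qf bf sh
  by unfold_locales
    (fact vec8_self qf_add bf_add bf_commute bf_nondegenerate card_vec8 card_qf sh_add qf_sh sh_15 sh_5 sh_3)+

lemma invariants_eq_orbit_type: "V.invariants x = orbit_type x"
  by (simp add: V.invariants_def orbit_type_def)

lemma V_orbit:
  assumes "x \<in> V.Q" "y \<in> V.Q" "V.invariants y = V.invariants x"
  shows "\<exists>k<15. x = (sh ^^ k) y"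
proof -
  obtain i j where i: "i < 15" "x = (sh ^^ i) (orbit_rep (orbit_type x))" and j: "j < 15" "y = (sh ^^ j) (orbit_rep (orbit_type x))"
    using walk_orbit_rep[of x] walk_orbit_rep[of y] assms by (auto simp: in_walk_iff V.Q_def invariants_eq_orbit_type)
  have "x = (sh ^^ (i + (15 - j))) y"
    unfolding funpow_add comp_apply using funpow_inverse[OF sh_15, of j "orbit_rep (orbit_type x)"] i j by simp
  also have "\<dots> = (sh ^^ ((i + (15 - j)) mod 15)) y"
    by (rule funpow_mod_eq[symmetric]) (rule sh_15)
  finally show ?thesis
    by (intro exI[of _ "(i + (15 - j)) mod 15"] conjI) simp_all
qed

lemma profile_sum: "V.profile p B = (\<Sum>x\<in>B. if orbit_type x = p then 1 else 0)"
  by (simp add: V.profile_def invariants_eq_orbit_type sum.If_cases Int_def)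

lemma witness:
  assumes "{a, b, c, d} \<subseteq> {x. qf x = 1}"
    "bf a b = 0" "bf a c = 0" "bf a d = 0" "bf b c = 0" "bf b d = 0" "bf c d = 0"
    "a \<noteq> b" "a \<noteq> c" "b \<noteq> c" "d \<notin> {a, b, c, a + b + c}"
    "(V.profile (0,0,0) (V.frame a b c d), V.profile (1,0,0) (V.frame a b c d),
      V.profile (0,1,0) (V.frame a b c d), V.profile (0,0,1) (V.frame a b c d)) = v"
  shows "\<exists>B\<in>V.V_bases. (V.profile (0,0,0) B, V.profile (1,0,0) B, V.profile (0,1,0) B, V.profile (0,0,1) B) = v"
proof -
  have "bf b a = 0" "bf c a = 0" "bf d a = 0" "bf c b = 0" "bf d b = 0" "bf d c = 0"
    using assms(2-7) bf_commute by metis+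
  with assms(1-7) have "V.orth {a, b, c, d}"
    by (simp add: V.orth_def V.Q_def)
  from V.frame_in_V_bases[OF this assms(8-11)] assms(12) show ?thesis by blast
qed

lemma witness_0: "v = (0,0,0,0) \<Longrightarrow> \<exists>B\<in>V.V_bases. (V.profile (0,0,0) B, V.profile (1,0,0) B, V.profile (0,1,0) B, V.profile (0,0,1) B) = v"
  \<comment> \<open>The first four unit vectors are mutually orthogonal because \<open>bf\<close>
    pairs unit vectors only at distances 4, 5 and 6.\<close>
  by (rule witness[of "(1,0,0,0,0,0,0,0)" "(0,1,0,0,0,0,0,0)" "(0,0,1,0,0,0,0,0)" "(0,0,0,1,0,0,0,0)"])
    (simp_all add: profile_sum V.frame_def orbit_type_def)

lemma witness_1: "v = (1,0,0,0) \<Longrightarrow> \<exists>B\<in>V.V_bases. (V.profile (0,0,0) B, V.profile (1,0,0) B, V.profile (0,1,0) B, V.profile (0,0,1) B) = v"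
  by (rule witness[of "(1,0,0,0,0,0,0,0)" "(0,1,0,0,0,0,0,0)" "(0,0,1,0,0,0,0,0)" "(0,0,0,0,1,0,1,1)"])
    (simp_all add: profile_sum V.frame_def orbit_type_def)

lemma witness_2: "v = (0,1,0,0) \<Longrightarrow> \<exists>B\<in>V.V_bases. (V.profile (0,0,0) B, V.profile (1,0,0) B, V.profile (0,1,0) B, V.profile (0,0,1) B) = v"
  by (rule witness[of "(1,0,0,0,0,0,0,0)" "(0,1,0,0,0,0,0,0)" "(0,0,0,1,0,1,1,0)" "(1,0,1,0,1,0,1,1)"])
    (simp_all add: profile_sum V.frame_def orbit_type_def)

lemma witness_3: "v = (0,0,1,0) \<Longrightarrow> \<exists>B\<in>V.V_bases. (V.profile (0,0,0) B, V.profile (1,0,0) B, V.profile (0,1,0) B, V.profile (0,0,1) B) = v"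
  by (rule witness[of "(1,0,0,0,0,0,0,0)" "(0,0,1,0,0,0,0,0)" "(1,0,0,0,1,1,0,0)" "(0,0,0,0,1,0,1,1)"])
    (simp_all add: profile_sum V.frame_def orbit_type_def)

lemma witness_4: "v = (0,0,0,1) \<Longrightarrow> \<exists>B\<in>V.V_bases. (V.profile (0,0,0) B, V.profile (1,0,0) B, V.profile (0,1,0) B, V.profile (0,0,1) B) = v"
  by (rule witness[of "(1,0,0,0,0,0,0,0)" "(0,0,0,1,0,0,0,0)" "(1,0,0,0,1,1,0,0)" "(1,0,1,0,1,0,1,0)"])
    (simp_all add: profile_sum V.frame_def orbit_type_def)

theorem V_count:
  "card {X. X \<subseteq> V.V_bases \<and> (`) sh ` X = X \<and> odd (card X) \<and> (\<forall>x\<in>V.Q. even (card {B \<in> X. x \<in> B}))} = 2 ^ 130"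
proof (rule V.card_invariant_parity_proofs)
  show "{orbit_rep (0,0,0), orbit_rep (1,0,0), orbit_rep (0,1,0), orbit_rep (0,0,1)} \<subseteq> V.Q"
    by (simp add: V.Q_def)
  show "V.invariants (orbit_rep (0,0,0)) = (0,0,0)" "V.invariants (orbit_rep (1,0,0)) = (1,0,0)"
      "V.invariants (orbit_rep (0,1,0)) = (0,1,0)" "V.invariants (orbit_rep (0,0,1)) = (0,0,1)"
    by (simp_all add: invariants_eq_orbit_type orbit_type_def)
next
  fix v :: "bit \<times> bit \<times> bit \<times> bit"
  assume "v \<in> {(0,0,0,0), (1,0,0,0), (0,1,0,0), (0,0,1,0), (0,0,0,1)}"
  then show "\<exists>B\<in>V.V_bases. (V.profile (0,0,0) B, V.profile (1,0,0) B, V.profile (0,1,0) B, V.profile (0,0,1) B) = v"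
    using witness_0 witness_1 witness_2 witness_3 witness_4 by blast
qed (rule V_orbit)

section \<open>The fifteenth cyclotomic polynomial\<close>

definition eval_int :: "int poly \<Rightarrow> 'a::comm_ring_1 \<Rightarrow> 'a" where
  "eval_int p z = poly (map_poly of_int p) z"

lemma eval_int_0 [simp]: "eval_int 0 z = 0"
  by (simp add: eval_int_def)

lemma eval_int_pCons [simp]: "eval_int (pCons a p) z = of_int a + z * eval_int p z"
  by (simp add: eval_int_def map_poly_pCons)

lemma eval_int_add: "eval_int (p + q) z = eval_int p z + eval_int q z"
  by (induction p q rule: poly_induct2) (simp_all add: algebra_simps)

lemma eval_int_smult: "eval_int (smult c p) z = of_int c * eval_int p z"
  by (induction p) (simp_all add: algebra_simps)

lemma eval_int_mult: "eval_int (p * q) z = eval_int p z * eval_int q z"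
  by (induction p) (simp_all add: eval_int_add eval_int_smult algebra_simps)

definition Phi15 :: "int poly" where
  "Phi15 = [:1, -1, 0, 1, -1, 1, 0, -1, 1:]"

lemma degree_Phi15: "degree Phi15 = 8" and Phi15_nonzero: "Phi15 \<noteq> 0"
  by (simp_all add: Phi15_def)

lemma int_dvd_primeE:
  fixes x p :: int
  assumes "x dvd p" "prime p"
  shows "x = 1 \<or> x = -1 \<or> x = p \<or> x = -p"
proof -
  have "\<bar>x\<bar> = 1 \<or> \<bar>x\<bar> = p"
    using assms by (simp add: prime_int_iff)
  then show ?thesis by linarith
qed

text \<open>A factor of \<open>\<Phi>\<^sub>1\<^sub>5\<close> divides the values 331, 1, 1, 1, 151 at \<open>-2, \<dots>, 2\<close>; interpolation shows
  that a factor of degree at most 4 with leading coefficient \<open>\<plusminus>1\<close> is constant.\<close>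

lemma small_factor_Phi15:
  assumes "d dvd Phi15" "degree d \<le> 4"
  shows "degree d = 0"
proof -
  obtain e where e: "Phi15 = d * e" using assms(1) by blast
  obtain c0 c1 c2 c3 c4 where d: "d = [:c0, c1, c2, c3, c4:]"
  proof -
    have "d = [:coeff d 0, coeff d 1, coeff d 2, coeff d 3, coeff d 4:]"
    proof (rule poly_eqI)
      fix n
      have "coeff d n = 0" if "n > 4"
        using that assms(2) by (intro coeff_eq_0) simp
      moreover have "n = 0 \<or> n = 1 \<or> n = 2 \<or> n = 3 \<or> n = 4 \<or> n > 4" by linarith
      ultimately show "coeff d n = coeff [:coeff d 0, coeff d 1, coeff d 2, coeff d 3, coeff d 4:] n"
        by (auto simp: numeral_eq_Suc coeff_pCons split: nat.split)
    qed
    then show thesis by (rule that)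
  qed
  have val: "poly d x dvd poly Phi15 x" for x by (simp add: e)
  have p: "prime (151::int)" "prime (331::int)" by simp_all
  have "poly d 0 dvd 1" "poly d 1 dvd 1" "poly d (-1) dvd 1" "poly d 2 dvd 151" "poly d (-2) dvd 331"
    using val[of 0] val[of 1] val[of "-1"] val[of 2] val[of "-2"] by (simp_all add: Phi15_def)
  then have v: "poly d 0 = 1 \<or> poly d 0 = -1" "poly d 1 = 1 \<or> poly d 1 = -1" "poly d (-1) = 1 \<or> poly d (-1) = -1"
    "poly d 2 = 1 \<or> poly d 2 = -1 \<or> poly d 2 = 151 \<or> poly d 2 = -151"
    "poly d (-2) = 1 \<or> poly d (-2) = -1 \<or> poly d (-2) = 331 \<or> poly d (-2) = -331"
    using int_dvd_primeE[OF _ p(1)] int_dvd_primeE[OF _ p(2)] by (auto simp: zdvd1_eq abs_if split: if_splits)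
  have "lead_coeff d * lead_coeff e = 1"
    using arg_cong[OF e, of lead_coeff] by (simp add: lead_coeff_mult Phi15_def)
  then have "lead_coeff d = 1 \<or> lead_coeff d = -1"
    using zmult_eq_1_iff by blast
  then have "c4 = 0 \<or> c4 = 1 \<or> c4 = -1"
    by (auto simp: d split: if_splits)
  note c4 = this
  define s1 where "s1 = poly d 1"
  define s1' where "s1' = poly d (-1)"
  define s2 where "s2 = poly d 2"
  define s2' where "s2' = poly d (-2)"
  have c0: "c0 = 1 \<or> c0 = -1" using v(1) by (simp add: d)
  note v = v(2-)[folded s1_def s1'_def s2_def s2'_def]
  have s: "s1 = c0 + c1 + c2 + c3 + c4" "s1' = c0 - c1 + c2 - c3 + c4"
    "s2 = c0 + 2 * c1 + 4 * c2 + 8 * c3 + 16 * c4" "s2' = c0 - 2 * c1 + 4 * c2 - 8 * c3 + 16 * c4"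
    by (simp_all add: s1_def s1'_def s2_def s2'_def d)
  \<comment> \<open>Adding values at opposite points keeps only the even part of \<open>d\<close>,
    and \<open>c2\<close> is then eliminated. The bound 38 = 8 + 6 + 24 rules out 151 and 331: any
    choice involving one of them makes the absolute value of the sum at least 150.\<close>
  then have E: "s2 + s2' = 4 * (s1 + s1') - 6 * c0 + 24 * c4" by simp
  then have "\<bar>s2 + s2'\<bar> \<le> 38"
    using v(1,2) c0 c4 by arith
  then have v2: "s2 = 1 \<or> s2 = -1" "s2' = 1 \<or> s2' = -1"
    using v(3,4) by (elim disjE; simp)+
  \<comment> \<open>The identity \<open>E\<close> makes \<open>s2 + s2' + 6 * c0\<close> a multiple
    of 8, which forces \<open>s2 = s2' = c0\<close>. The multiple is then \<open>8 * c0\<close>, so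
    \<open>c4 = 0\<close> and also \<open>s1 = s1' = c0\<close>. Now \<open>d\<close> has degree at
    most 3 and takes the value \<open>c0\<close> at five points.\<close>
  have c4: "c4 = 0" using E v(1,2) v2 c0 c4 by (elim disjE) simp_all
  with E v(1,2) v2 c0 have "s1 = c0 \<and> s1' = c0 \<and> s2 = c0 \<and> s2' = c0"
    by (elim disjE) simp_all
  with s c4 have "c1 + c2 + c3 = 0" "c2 = c1 + c3" "2 * c1 + 4 * c2 + 8 * c3 = 0"
    by linarith+
  then have "c1 = 0 \<and> c2 = 0 \<and> c3 = 0" by linarith
  with c4 show ?thesis by (simp add: d)
qed

text \<open>In the identity \<open>(z^5 - 1) (z^3 - 1) Phi15(z) = (z^15 - 1) (z - 1)\<close> the
  right side vanishes, while \<open>z^5\<close> and \<open>z^3\<close> have the arguments 120 and 72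
  degrees and so differ from 1.\<close>

lemma zeta15_roots:
  fixes z :: complex
  defines "z \<equiv> cis (24 * pi / 180)"
  shows "eval_int Phi15 z = 0"
proof -
  have pow: "z ^ n = cis (real n * (24 * pi / 180))" for n
    unfolding z_def by (rule Complex.DeMoivre)
  have "z ^ 15 = 1"
    by (simp add: pow flip: cis_2pi)
  have "z ^ 5 \<noteq> 1"
  proof
    assume "z ^ 5 = 1"
    then have "Im (cis (2 * pi / 3)) = 0" unfolding pow by (simp add: algebra_simps)
    moreover have "sin (2 * pi / 3) > 0" by (rule sin_gt_zero) (use pi_gt_zero in auto)
    ultimately show False by simp
  qed
  have "z ^ 3 \<noteq> 1"
  proof
    assume "z ^ 3 = 1"
    then have "Im (cis (2 * pi / 5)) = 0" unfolding pow by (simp add: algebra_simps)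
    moreover have "sin (2 * pi / 5) > 0" by (rule sin_gt_zero) (use pi_gt_zero in auto)
    ultimately show False by simp
  qed
  have "(z ^ 5 - 1) * (z ^ 3 - 1) * eval_int Phi15 z = (z ^ 15 - 1) * (z - 1)"
    by (simp add: Phi15_def algebra_simps eval_nat_numeral)
  then show ?thesis
    using \<open>z ^ 15 = 1\<close> \<open>z ^ 5 \<noteq> 1\<close> \<open>z ^ 3 \<noteq> 1\<close> by simp
qed

text \<open>A relation of least degree, made primitive, divides \<open>Phi15\<close> over the
  integers: pseudo-division leaves no remainder, and Gauss's lemma on primitive parts removes the
  multiplier. The degrees of the two factors add up to 8, so one factor has degree at most 4 and is
  constant by \<open>small_factor_Phi15\<close>.\<close>

lemma no_small_relation:
  fixes z :: complex
  assumes z: "eval_int Phi15 z = 0" and p: "eval_int p z = 0" "p \<noteq> 0"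
  shows "degree p \<ge> 8"
proof (rule ccontr)
  assume "\<not> degree p \<ge> 8"
  define P where "P n \<longleftrightarrow> (\<exists>p. p \<noteq> 0 \<and> eval_int p z = 0 \<and> degree p = n)" for n
  have ex: "P (degree p)" using p by (auto simp: P_def)
  define n where "n = (LEAST n. P n)"
  have "P n" "n \<le> degree p" unfolding n_def using ex by (auto intro: LeastI Least_le)
  then obtain r where r: "r \<noteq> 0" "eval_int r z = 0" "degree r = n" by (auto simp: P_def)
  define m where "m = primitive_part r"
  have "r = smult (content r) m" by (simp add: m_def)
  then have m: "m \<noteq> 0" "eval_int m z = 0" "degree m = n" 
    using r by (auto simp: m_def) (metis eval_int_smult mult_eq_0_iff of_int_eq_0_iff content_eq_zero_iff \<open>r = smult (content r) m\<close> m_def)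
  have "n > 0"
  proof (rule ccontr)
    assume "\<not> n > 0"
    then obtain a where "m = [:a:]" using m(3) by (metis neq0_conv degree_eq_zeroE)
    with m show False by simp
  qed
  have "m dvd Phi15"
  proof -
    define s where "s = pseudo_mod Phi15 m"
    obtain a q where aq: "a \<noteq> 0" "smult a Phi15 = m * q + s" and s: "s = 0 \<or> degree s < degree m"
      using pseudo_mod[OF m(1), of Phi15] by (auto simp: s_def)
    have "eval_int s z = 0"
      using arg_cong[OF aq(2), of "\<lambda>p. eval_int p z"] by (simp add: eval_int_add eval_int_smult eval_int_mult z m(2))
    then have "s = 0"
      using s m(3) not_less_Least[of "degree s" P] by (auto simp: P_def n_def)
    then have "primitive_part (smult a Phi15) = primitive_part m * primitive_part q"
      using aq by (simp add: primitive_part_mult)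
    moreover have "primitive_part m = m"
      using r(1) by (simp add: m_def primitive_part_prim)
    moreover have "primitive_part Phi15 = Phi15"
      by (rule primitive_part_prim) (simp add: Phi15_def content_def)
    ultimately have "smult (unit_factor a) Phi15 = m * primitive_part q"
      by (simp add: primitive_part_smult)
    then have "m dvd smult (unit_factor a) Phi15" by simp
    then show ?thesis using aq(1) by (cases "a > 0") (simp_all add: sgn_if)
  qed
  then obtain e where e: "Phi15 = m * e" by blast
  then have "e \<noteq> 0" using Phi15_nonzero by auto
  then have "degree m + degree e = 8"
    using e m degree_Phi15 by (metis degree_mult_eq)
  moreover have "degree m = 0" if "degree m \<le> 4"
    using small_factor_Phi15[of m] e that by (metis dvd_triv_left)
  moreover have "degree e = 0" if "degree e \<le> 4"
    using small_factor_Phi15[of e] e that by (metis dvd_triv_right)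
  ultimately show False
    using \<open>n > 0\<close> m(3) \<open>n \<le> degree p\<close> \<open>\<not> degree p \<ge> 8\<close> by linarith
qed

lemma eval_int_monom: "eval_int (monom a n) z = of_int a * z ^ n"
  by (induction n) (simp_all add: monom_Suc monom_0 algebra_simps)

lemma eval_int_sum: "eval_int (sum f A) z = (\<Sum>i\<in>A. eval_int (f i) z)"
  by (induction A rule: infinite_finite_induct) (simp_all add: eval_int_add)

lemma zeta15_independent:
  fixes z :: complex
  assumes z: "eval_int Phi15 z = 0" and c: "(\<Sum>i<8. of_int (c i) * z ^ i) = 0" and "j < 8"
  shows "c j = 0"
proof -
  define p where "p = (\<Sum>i<8. monom (c i) i)"
  have coeff: "coeff p i = (if i < 8 then c i else 0)" for i
    by (simp add: p_def coeff_sum if_distrib sum.delta cong: if_cong)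
  have "eval_int p z = 0"
    using c by (simp add: p_def eval_int_sum eval_int_monom)
  moreover have "degree p < 8"
    using degree_le[of 7 p] by (simp add: coeff)
  ultimately have "p = 0" using no_small_relation[OF z] by force
  with coeff[of j] \<open>j < 8\<close> show ?thesis by simp
qed

text \<open>Subtracting \<open>c 8\<close> times the cyclotomic relation leaves a relation of degree
  below 8, which is trivial.\<close>

lemma zeta15_relation:
  fixes z :: complex
  assumes z: "eval_int Phi15 z = 0" and c: "(\<Sum>i<9. of_int (c i) * z ^ i) = 0" and "j < 9"
  shows "c j = c 8 * coeff Phi15 j"
proof -
  define b where "b i = c i - c 8 * coeff Phi15 i" for i
  have Phi: "(\<Sum>i<9. of_int (coeff Phi15 i) * z ^ i) = 0"
    using z by (simp add: Phi15_def eval_nat_numeral algebra_simps)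
  have "(\<Sum>i<9. of_int (b i) * z ^ i) =
      (\<Sum>i<9. of_int (c i) * z ^ i) - of_int (c 8) * (\<Sum>i<9. of_int (coeff Phi15 i) * z ^ i)"
    by (simp only: b_def sum_distrib_left flip: sum_subtractf) (simp add: algebra_simps)
  then have "(\<Sum>i<9. of_int (b i) * z ^ i) = 0" by (simp add: c Phi)
  moreover have "b 8 = 0"
    by (simp add: b_def Phi15_def eval_nat_numeral)
  ultimately have "(\<Sum>i<8. of_int (b i) * z ^ i) = 0"
    by (simp add: eval_nat_numeral)
  then have "b j = 0" if "j < 8" using zeta15_independent[OF z] that by blast
  with \<open>b 8 = 0\<close> have "b j = 0" using \<open>j < 9\<close> by (cases "j = 8") auto
  then show ?thesis by (simp add: b_def)
qed

section \<open>The lattice and its symmetries\<close>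

lemma E8_lattice_add:
  assumes "x \<in> E8_lattice" "y \<in> E8_lattice"
  shows "x + y \<in> E8_lattice"
proof -
  have "(\<Sum>i\<in>UNIV. (x + y) $ i) / 2 = (\<Sum>i\<in>UNIV. x $ i) / 2 + (\<Sum>i\<in>UNIV. y $ i) / 2"
    by (simp add: sum.distrib add_divide_distrib)
  then have s: "(\<Sum>i\<in>UNIV. (x + y) $ i) / 2 \<in> \<int>"
    using assms unfolding E8_lattice_def by (metis (no_types, lifting) Ints_add mem_Collect_eq)
  have hh: "a + b \<in> \<int>" if "a - 1/2 \<in> \<int>" "b - 1/2 \<in> \<int>" for a b :: real
    using Ints_add[OF Ints_add[OF that] Ints_1] by (simp add: algebra_simps)
  have hi: "a + b - 1/2 \<in> \<int>" "b + a - 1/2 \<in> \<int>" if "a - 1/2 \<in> \<int>" "b \<in> \<int>" for a b :: real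
    using Ints_add[OF that] by (simp_all add: algebra_simps)
  have "(\<forall>i. x $ i \<in> \<int>) \<or> (\<forall>i. x $ i - 1/2 \<in> \<int>)" "(\<forall>i. y $ i \<in> \<int>) \<or> (\<forall>i. y $ i - 1/2 \<in> \<int>)"
    using assms by (simp_all add: E8_lattice_def)
  then have "(\<forall>i. (x + y) $ i \<in> \<int>) \<or> (\<forall>i. (x + y) $ i - 1/2 \<in> \<int>)"
    using hh hi by (elim disjE) (simp_all only: vector_add_component Ints_add simp_thms)
  with s show ?thesis by (simp add: E8_lattice_def)
qed

lemma E8_lattice_uminus:
  assumes "x \<in> E8_lattice"
  shows "- x \<in> E8_lattice"
proof -
  have "- a - 1/2 \<in> \<int>" if "a - 1/2 \<in> \<int>" for a :: real
    using Ints_diff[OF Ints_minus[OF that] Ints_1] by (simp add: algebra_simps)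
  then show ?thesis
    using assms by (auto simp: E8_lattice_def sum_negf)
qed

lemma E8_lattice_diff: "x \<in> E8_lattice \<Longrightarrow> y \<in> E8_lattice \<Longrightarrow> x - y \<in> E8_lattice"
  using E8_lattice_add[of x "- y"] E8_lattice_uminus[of y] by simp

lemma E8_lattice_inner:
  assumes x: "x \<in> E8_lattice" and y: "y \<in> E8_lattice"
  shows "x \<bullet> y \<in> \<int>"
proof -
  have sx: "(\<Sum>i\<in>UNIV. x $ i) / 2 \<in> \<int>" and sy: "(\<Sum>i\<in>UNIV. y $ i) / 2 \<in> \<int>"
    using x y by (simp_all add: E8_lattice_def)
  have mixed: "v \<bullet> w \<in> \<int>" if "\<forall>i. v $ i \<in> \<int>" "\<forall>i. w $ i - 1/2 \<in> \<int>" "(\<Sum>i\<in>UNIV. v $ i) / 2 \<in> \<int>" for v w :: "real ^ 8"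
  proof -
    have "v \<bullet> w = (\<Sum>i\<in>UNIV. v $ i * (w $ i - 1/2)) + (\<Sum>i\<in>UNIV. v $ i) / 2"
      by (simp add: inner_vec_def algebra_simps sum.distrib sum_divide_distrib flip: sum.distrib)
    then show ?thesis using that by (metis (no_types, lifting) Ints_add Ints_mult Ints_sum)
  qed
  have int: "v \<bullet> w \<in> \<int>" if "\<forall>i. v $ i \<in> \<int>" "\<forall>i. w $ i \<in> \<int>" for v w :: "real ^ 8"
    unfolding inner_vec_def by (rule Ints_sum) (simp add: that)
  have half: "x \<bullet> y \<in> \<int>" if "\<forall>i. x $ i - 1/2 \<in> \<int>" "\<forall>i. y $ i - 1/2 \<in> \<int>"
  proof -
    \<comment> \<open>Expansion of the products of the shifted coordinates; the 2 is eight times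
      1/4.\<close>
    have "x \<bullet> y = (\<Sum>i\<in>UNIV. (x $ i - 1/2) * (y $ i - 1/2)) + (\<Sum>i\<in>UNIV. x $ i) / 2 + (\<Sum>i\<in>UNIV. y $ i) / 2 - 2"
    proof -
      have "(\<Sum>i\<in>UNIV. (x $ i - 1/2) * (y $ i - 1/2)) =
          (\<Sum>i\<in>UNIV. x $ i * y $ i - x $ i / 2 - y $ i / 2 + 1 / 4)"
        by (rule sum.cong) (simp_all add: algebra_simps)
      then show ?thesis
        by (simp add: inner_vec_def sum.distrib sum_subtractf sum_divide_distrib)
    qed
    moreover have "(\<Sum>i\<in>UNIV. (x $ i - 1/2) * (y $ i - 1/2)) \<in> \<int>"
      by (rule Ints_sum) (simp add: that)
    ultimately show ?thesis using sx sy by simp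
  qed
  show ?thesis
    using x y mixed[of x y] mixed[of y x] int half sx sy
    by (auto simp: E8_lattice_def inner_commute)
qed

section \<open>Integral relations between half-integral vectors\<close>

lemma vec_relation:
  fixes w :: "nat \<Rightarrow> 'a::field ^ 'n"
  assumes "CARD('n) < m"
  obtains c where "\<exists>i<m. c i \<noteq> 0" "(\<Sum>i<m. c i *s w i) = 0"
proof (cases "inj_on w {..<m}")
  case True
  have "card (w ` {..<m}) > vec.dim (w ` {..<m})"
    using card_image[OF True] assms dim_subset_UNIV_cart_gen[of "w ` {..<m}"] by simp
  then have "vec.dependent (w ` {..<m})"
    using vec.independent_bound_general by (metis leD)
  then obtain f where f: "(\<Sum>v\<in>w ` {..<m}. f v *s v) = 0" "\<exists>v\<in>w ` {..<m}. f v \<noteq> 0"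
    by (auto simp: vec.dependent_finite)
  show thesis
  proof
    show "(\<Sum>i<m. (f \<circ> w) i *s w i) = 0"
      using f(1) by (simp add: sum.reindex[OF True])
  qed (use f(2) in auto)
next
  case False
  then obtain i j where ij: "i < m" "j < m" "i \<noteq> j" "w i = w j" by (auto simp: inj_on_def)
  show thesis
  proof
    show "\<exists>k<m. (if k = i then 1 else if k = j then - 1 else 0 :: 'a) \<noteq> 0" using ij by auto
    have "(\<Sum>k<m. (if k = i then 1 else if k = j then - 1 else 0) *s w k) =
      (\<Sum>k\<in>{i, j}. (if k = i then 1 else if k = j then - 1 else 0) *s w k)"
      using ij by (intro sum.mono_neutral_right) auto
    then show "(\<Sum>k<m. (if k = i then 1 else if k = j then - 1 else 0) *s w k) = 0"
      using ij by simp
  qed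
qed

lemma common_denominator:
  fixes c :: "nat \<Rightarrow> rat"
  obtains D :: int and a :: "nat \<Rightarrow> int" where "D \<noteq> 0" "\<And>i. i < m \<Longrightarrow> of_int (a i) = of_int D * c i"
proof -
  have "\<exists>D a. D \<noteq> (0::int) \<and> (\<forall>i<m. of_int (a i) = of_int D * c i)"
  proof (induction m)
    case (Suc m)
    then obtain D a where D: "D \<noteq> 0" "\<forall>i<m. of_int (a i) = of_int D * c i" by blast
    obtain p q where q: "c m = of_int p / of_int q" "q \<noteq> 0"
      by (metis quotient_of_div quotient_of_denom_pos less_irrefl surj_pair)
    show ?case
    proof (intro exI conjI allI impI)
      show "D * q \<noteq> 0" using D q by simp
      show "of_int (if i = m then D * p else a i * q) = of_int (D * q) * c i" if "i < Suc m" for i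
        using that D q by (auto simp: less_Suc_eq)
    qed
  qed (auto intro: exI[of _ 1])
  with that show thesis by blast
qed

text \<open>Doubled coordinates are integers, so nine such vectors are dependent over the rationals
  and denominators can be cleared. A relation with real coefficients could not be compared with the
  cyclotomic polynomial.\<close>

lemma half_integral_relation:
  fixes w :: "nat \<Rightarrow> real ^ 8"
  assumes w: "\<And>i j. i < 9 \<Longrightarrow> 2 * w i $ j \<in> \<int>"
  obtains a :: "nat \<Rightarrow> int" where "\<exists>i<9. a i \<noteq> 0" "(\<Sum>i<9. of_int (a i) *\<^sub>R w i) = 0"
proof -
  define W :: "nat \<Rightarrow> rat ^ 8" where "W i = (\<chi> j. of_int \<lfloor>2 * w i $ j\<rfloor>)" for i
  obtain c where c: "\<exists>i<9. c i \<noteq> 0" "(\<Sum>i<9. c i *s W i) = 0"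
    by (rule vec_relation[of 9 W]) auto
  obtain D a where D: "D \<noteq> 0" "\<And>i. i < 9 \<Longrightarrow> of_int (a i) = of_int D * c i"
    using common_denominator[of 9 c] by blast
  show thesis
  proof
    show "\<exists>i<9. a i \<noteq> 0" using c(1) D by (metis mult_eq_0_iff of_int_0 of_int_eq_0_iff)
    show "(\<Sum>i<9. of_int (a i) *\<^sub>R w i) = 0"
    proof (subst vec_eq_iff, rule allI)
      fix j
      have "(\<Sum>i<9. c i * of_int \<lfloor>2 * w i $ j\<rfloor>) = 0"
        using arg_cong[OF c(2), of "\<lambda>v. v $ j"] by (simp add: W_def)
      then have "of_int D * (\<Sum>i<9. c i * of_int \<lfloor>2 * w i $ j\<rfloor>) = 0" by simp
      then have "(\<Sum>i<9. of_int (a i) * of_int \<lfloor>2 * w i $ j\<rfloor> :: rat) = 0"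
        by (simp add: sum_distrib_left D(2) mult.assoc)
      then have "of_int (\<Sum>i<9. a i * \<lfloor>2 * w i $ j\<rfloor>) = (0::rat)" by simp
      then have "(\<Sum>i<9. a i * \<lfloor>2 * w i $ j\<rfloor>) = 0" by (simp only: of_int_eq_0_iff)
      then have "(\<Sum>i<9. of_int (a i) * of_int \<lfloor>2 * w i $ j\<rfloor> :: real) = 0"
        by (metis (mono_tags, lifting) of_int_0 of_int_mult of_int_sum sum.cong)
      then have "(\<Sum>i<9. of_int (a i) * (2 * w i $ j)) = 0"
        using w by simp
      then have "2 * (\<Sum>i<9. of_int (a i) * w i $ j) = 0"
        by (simp only: sum_distrib_left mult.left_commute)
      then show "(\<Sum>i<9. of_int (a i) *\<^sub>R w i) $ j = 0 $ j" by simp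
    qed
  qed
qed

lemma E8_lattice_half_integral: "x \<in> E8_lattice \<Longrightarrow> 2 * x $ j \<in> \<int>"
proof -
  assume "x \<in> E8_lattice"
  then consider "x $ j \<in> \<int>" | "x $ j - 1/2 \<in> \<int>" by (auto simp: E8_lattice_def)
  then show ?thesis
  proof cases
    case 2
    then have "2 * (x $ j - 1/2) + 1 \<in> \<int>" by (intro Ints_add Ints_mult) auto
    moreover have "2 * (x $ j - 1/2) + 1 = 2 * x $ j" by (simp add: algebra_simps)
    ultimately show ?thesis by metis
  qed simp
qed

section \<open>The action on the roots and on the plane\<close>

lemma symmetry_preserves_roots:
  assumes "polytope_symmetry g"
  shows "g ` E8_roots = E8_roots"
proof -
  have g: "linear g" "inj g" "g ` gosset_polytope = gosset_polytope"
    using assms by (auto simp: polytope_symmetry_def orthogonal_transformation_linear orthogonal_transformation_inj)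
  have "g x extreme_point_of gosset_polytope \<longleftrightarrow> x extreme_point_of gosset_polytope" for x
    using face_of_linear_image[OF g(1,2), of "{x}" gosset_polytope]
    by (simp add: g(3) face_of_singleton)
  moreover have "x \<in> range g" if "x extreme_point_of gosset_polytope" for x
    using that g(3) unfolding extreme_point_of_def by blast
  ultimately have "g ` gosset_vertices = gosset_vertices"
    unfolding gosset_vertices_def by blast
  then show ?thesis by (simp add: gosset_vertices_eq)
qed

text \<open>A root orthogonal to \<open>P\<close> would be projected to 0, but the projected
  vertices lie on 30-gons of positive radius.\<close>

lemma root_not_orthogonal_plane:
  assumes P: "triacontagonal_plane P" and v: "v \<in> E8_roots"
  shows "\<exists>y\<in>P. v \<bullet> y \<noteq> 0"
proof (rule ccontr)
  assume "\<not> (\<exists>y\<in>P. v \<bullet> y \<noteq> 0)"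
  then have orth: "v \<bullet> y = 0" if "y \<in> P" for y using that by auto
  have sub: "subspace P" using P by (simp add: triacontagonal_plane_def)
  have "0 = closest_point P v"
  proof (rule closest_point_unique)
    show "\<forall>z\<in>P. dist v 0 \<le> dist v z"
    proof
      fix z assume "z \<in> P"
      then have "norm (v - z) ^ 2 = norm v ^ 2 + norm z ^ 2"
        using orth[of z] by (simp add: power2_norm_eq_inner inner_diff inner_commute)
      then have "norm v ^ 2 \<le> norm (v - z) ^ 2" by simp
      then show "dist v 0 \<le> dist v z" by (simp add: dist_norm)
    qed
  qed (use sub in \<open>auto simp: subspace_imp_convex closed_subspace subspace_0\<close>)
  moreover obtain F where F: "\<forall>S\<in>F. regular_ngon 30 P S" "closest_point P ` gosset_vertices = \<Union>F"
    using P by (auto simp: triacontagonal_plane_def)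
  ultimately obtain S where "S \<in> F" "0 \<in> S"
    using v by (metis UnionE gosset_vertices_eq imageI)
  then obtain e1 e2 r t where e: "orthonormal_frame P e1 e2" "r > 0"
    and z: "0 = r *\<^sub>R (cos t *\<^sub>R e1 + sin t *\<^sub>R e2)"
    using F(1) unfolding regular_ngon_def by fastforce
  have "e1 \<bullet> e1 = 1" "e2 \<bullet> e2 = 1" "e1 \<bullet> e2 = 0" "e2 \<bullet> e1 = 0"
    using e(1) by (auto simp: orthonormal_frame_def orthogonal_def norm_eq_1 inner_commute)
  moreover have "cos t *\<^sub>R e1 + sin t *\<^sub>R e2 = 0" using z e(2) by simp
  then have "(cos t *\<^sub>R e1 + sin t *\<^sub>R e2) \<bullet> e1 = 0" "(cos t *\<^sub>R e1 + sin t *\<^sub>R e2) \<bullet> e2 = 0"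
    by simp_all
  ultimately have "cos t = 0" "sin t = 0" by (simp_all add: inner_add_left)
  then show False using sin_cos_squared_add[of t] by simp
qed

locale E8_rotation =
  fixes g :: "real ^ 8 \<Rightarrow> real ^ 8"
  assumes orthogonal: "orthogonal_transformation g"
    and roots: "g ` E8_roots = E8_roots"
    and cyclotomic: "v \<in> E8_roots \<Longrightarrow>
      (g ^^ 8) v = (g ^^ 7) v - (g ^^ 5) v + (g ^^ 4) v - (g ^^ 3) v + g v - v"
    and independent: "v \<in> E8_roots \<Longrightarrow> (\<Sum>i<8. of_int (c i) *\<^sub>R (g ^^ i) v) = 0 \<Longrightarrow> j < 8 \<Longrightarrow> c j = 0"

text \<open>Irreducibility only bounds relations from below; that one of degree 8 exists is due to
  dimension. The nine vectors from \<open>v\<close> to the eighth iterate are half-integral in an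
  8-dimensional space, and their integral relation, seen in the plane, must be a nonzero multiple of
  \<open>Phi15\<close>.\<close>

lemma E8_rotationI:
  assumes P: "triacontagonal_plane P" and sym: "polytope_symmetry g" and rot: "rotates_plane_by g P (24 * pi / 180)"
  shows "E8_rotation g"
proof -
  let ?\<theta> = "24 * pi / 180"
  obtain e1 e2 where fr: "orthonormal_frame P e1 e2"
    and ge: "g e1 = cos ?\<theta> *\<^sub>R e1 + sin ?\<theta> *\<^sub>R e2" "g e2 = - sin ?\<theta> *\<^sub>R e1 + cos ?\<theta> *\<^sub>R e2"
    using rot by (auto simp: rotates_plane_by_def)
  have og: "orthogonal_transformation g" and roots: "g ` E8_roots = E8_roots"
    using sym symmetry_preserves_roots by (auto simp: polytope_symmetry_def)
  \<comment> \<open>Orthogonal projection to \<open>P\<close>, read as a complex coordinate in the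
    given frame.\<close>
  define Z where "Z x = Complex (x \<bullet> e1) (x \<bullet> e2)" for x
  define z where "z = cis ?\<theta>"
  have Phi: "eval_int Phi15 z = 0" unfolding z_def by (rule zeta15_roots)
  have Z_sum: "Z (\<Sum>i<n. of_int (c i) *\<^sub>R w i) = (\<Sum>i<n. of_int (c i) * Z (w i))" for c :: "nat \<Rightarrow> int" and w n
    by (induction n) (simp_all add: Z_def complex_eq_iff inner_add_left)
  have Z_g: "Z (g x) = z * Z x" for x
  proof -
    \<comment> \<open>The hypothesis describes \<open>g\<close> on the frame, whereas
      \<open>Z (g x)\<close> pairs \<open>g x\<close> with the frame. Invariance of the inner
      product gives the inverse rotation, which is solved for the coordinates of
      \<open>g x\<close>.\<close>
    have rotate_back: "p = c * a - s * b" "r = s * a + c * b"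
      if "c * p + s * r = a" "- s * p + c * r = b" "s\<^sup>2 + c\<^sup>2 = 1" for p r a b c s :: real
    proof -
      have "c * a - s * b = (s\<^sup>2 + c\<^sup>2) * p" "s * a + c * b = (s\<^sup>2 + c\<^sup>2) * r"
        unfolding that(1,2)[symmetric] by (simp_all add: algebra_simps power2_eq_square)
      then show "p = c * a - s * b" "r = s * a + c * b" using that(3) by simp_all
    qed
    have "g x \<bullet> g y = x \<bullet> y" for y using og by (simp add: orthogonal_transformation_def)
    from this[of e1] this[of e2]
    have "cos ?\<theta> * (g x \<bullet> e1) + sin ?\<theta> * (g x \<bullet> e2) = x \<bullet> e1"
      "- sin ?\<theta> * (g x \<bullet> e1) + cos ?\<theta> * (g x \<bullet> e2) = x \<bullet> e2"
      unfolding ge inner_add_right inner_scaleR_right by simp_all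
    from rotate_back[OF this sin_cos_squared_add]
    show ?thesis by (simp add: Z_def z_def complex_eq_iff)
  qed
  have Z_pow: "Z ((g ^^ i) x) = z ^ i * Z x" for i x
    by (induction i) (simp_all add: Z_g)
  have Z_nz: "Z v \<noteq> 0" if v: "v \<in> E8_roots" for v
  proof
    assume "Z v = 0"
    then have "v \<bullet> e1 = 0" "v \<bullet> e2 = 0" by (simp_all add: Z_def complex_eq_iff)
    then have "{e1, e2} \<subseteq> {y. v \<bullet> y = 0}" by simp
    then have "span {e1, e2} \<subseteq> {y. v \<bullet> y = 0}"
      by (intro span_minimal subspace_hyperplane)
    then show False
      using root_not_orthogonal_plane[OF P v] fr by (auto simp: orthonormal_frame_def)
  qed
  have rel: "(\<Sum>i<n. of_int (c i) * z ^ i) = 0" if "v \<in> E8_roots" "(\<Sum>i<n. of_int (c i) *\<^sub>R (g ^^ i) v) = 0" for v c n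
  proof -
    have "(\<Sum>i<n. of_int (c i) * z ^ i) * Z v = Z (\<Sum>i<n. of_int (c i) *\<^sub>R (g ^^ i) v)"
      unfolding Z_sum Z_pow by (simp add: sum_distrib_right mult.assoc)
    also have "\<dots> = 0" unfolding that(2) by (simp add: Z_def complex_eq_iff)
    finally show ?thesis using Z_nz[OF that(1)] by simp
  qed
  show ?thesis
  proof
    fix v c and j :: nat
    assume "v \<in> E8_roots" "(\<Sum>i<8. of_int (c i) *\<^sub>R (g ^^ i) v) = 0" "j < 8"
    then show "c j = 0" using zeta15_independent[OF Phi rel] by blast
  next
    fix v assume v: "v \<in> E8_roots"
    have "(g ^^ i) v \<in> E8_roots" for i using v roots by (induction i) auto
    then have lat: "(g ^^ i) v \<in> E8_lattice" for i by (auto simp: E8_roots_def)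
    obtain a :: "nat \<Rightarrow> int" where a: "\<exists>i<9. a i \<noteq> 0" "(\<Sum>i<9. of_int (a i) *\<^sub>R (g ^^ i) v) = 0"
      by (rule half_integral_relation[of "\<lambda>i. (g ^^ i) v", OF E8_lattice_half_integral[OF lat]])
    have c: "a i = a 8 * coeff Phi15 i" if "i < 9" for i
      using zeta15_relation[OF Phi rel[OF v a(2)] that] .
    have a8: "a 8 \<noteq> 0"
    proof
      assume "a 8 = 0"
      then have "a i = 0" if "i < 9" for i using c[OF that] by simp
      with a(1) show False by blast
    qed
    have scale: "of_int (a i) *\<^sub>R w = of_int (a 8) *\<^sub>R of_int (coeff Phi15 i) *\<^sub>R w" if "i < 9" for i and w :: "real ^ 8"
      using arg_cong[OF c[OF that], of "\<lambda>n. of_int n *\<^sub>R w"] by simp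
    have "(\<Sum>i<9. of_int (a i) *\<^sub>R (g ^^ i) v) = of_int (a 8) *\<^sub>R (\<Sum>i<9. of_int (coeff Phi15 i) *\<^sub>R (g ^^ i) v)"
      unfolding scaleR_sum_right by (rule sum.cong[OF refl scale]) simp
    then have "(\<Sum>i<9. of_int (coeff Phi15 i) *\<^sub>R (g ^^ i) v) = 0" using a(2) a8 by simp
    then show "(g ^^ 8) v = (g ^^ 7) v - (g ^^ 5) v + (g ^^ 4) v - (g ^^ 3) v + g v - v"
      by (simp add: Phi15_def eval_nat_numeral algebra_simps add_eq_0_iff)
  qed (use og roots in auto)
qed

section \<open>A normal form for the rotation\<close>

context E8_rotation
begin

definition U :: "real ^ 8 \<Rightarrow> nat \<Rightarrow> real ^ 8" where
  "U v i = (g ^^ i) v"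

definition autocorr :: "real ^ 8 \<Rightarrow> nat \<Rightarrow> real" where
  "autocorr v k = U v 0 \<bullet> U v k"

lemma g_inner: "g x \<bullet> g y = x \<bullet> y"
  using orthogonal by (simp add: orthogonal_transformation_def)

lemma linear_g: "linear g"
  using orthogonal by (rule orthogonal_transformation_linear)

lemma U_add: "U (x + y) i = U x i + U y i" and U_diff: "U (x - y) i = U x i - U y i"
  by (induction i) (simp_all add: U_def linear_add[OF linear_g] linear_diff[OF linear_g])

lemma U_U: "U (U v i) j = U v (i + j)"
  by (simp add: U_def funpow_add add.commute[of i j])

lemma U_0: "U v 0 = v"
  by (simp add: U_def)

lemma U_inner: "U x i \<bullet> U y i = x \<bullet> y"
  by (induction i) (simp_all add: U_def g_inner)

lemma U_inner_U: "U v i \<bullet> U v j = autocorr v (if i \<le> j then j - i else i - j)"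
proof -
  have "U v i \<bullet> U v (i + k) = autocorr v k" for i k
    using U_inner[of v i "U v k"] by (simp add: autocorr_def U_U U_0 add.commute)
  from this[of i "j - i"] this[of j "i - j"] show ?thesis
    by (cases "i \<le> j") (simp_all add: inner_commute)
qed

lemma U_root: "v \<in> E8_roots \<Longrightarrow> U v i \<in> E8_roots"
  unfolding U_def by (induction i) (use roots in auto)

lemma U_lattice: "v \<in> E8_roots \<Longrightarrow> U v i \<in> E8_lattice"
  using U_root by (auto simp: E8_roots_def)

lemma U_recurrence:
  assumes "v \<in> E8_roots"
  shows "U v (8 + j) = U v (7 + j) - U v (5 + j) + U v (4 + j) - U v (3 + j) + U v (1 + j) - U v j"
  using cyclotomic[OF U_root[OF assms], of j] by (simp add: U_def funpow_add)

text \<open>The polynomial \<open>X^15 - 1\<close> is a multiple of \<open>Phi15\<close>; eight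
  instances of the recurrence carry out the division.\<close>

lemma U_15:
  assumes "v \<in> E8_roots"
  shows "U v 15 = v"
proof -
  note r = U_recurrence[OF assms]
  have "U v 8 = U v 7 - U v 5 + U v 4 - U v 3 + U v 1 - U v 0" using r[of 0] by (simp del: One_nat_def)
  moreover have "U v 9 = U v 8 - U v 6 + U v 5 - U v 4 + U v 2 - U v 1" using r[of 1] by (simp del: One_nat_def)
  moreover have "U v 10 = U v 9 - U v 7 + U v 6 - U v 5 + U v 3 - U v 2" using r[of 2] by (simp del: One_nat_def)
  moreover have "U v 11 = U v 10 - U v 8 + U v 7 - U v 6 + U v 4 - U v 3" using r[of 3] by (simp del: One_nat_def)
  moreover have "U v 12 = U v 11 - U v 9 + U v 8 - U v 7 + U v 5 - U v 4" using r[of 4] by (simp del: One_nat_def)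
  moreover have "U v 13 = U v 12 - U v 10 + U v 9 - U v 8 + U v 6 - U v 5" using r[of 5] by (simp del: One_nat_def)
  moreover have "U v 14 = U v 13 - U v 11 + U v 10 - U v 9 + U v 7 - U v 6" using r[of 6] by (simp del: One_nat_def)
  moreover have "U v 15 = U v 14 - U v 12 + U v 11 - U v 10 + U v 8 - U v 7" using r[of 7] by (simp del: One_nat_def)
  ultimately have "U v 15 = U v 0" by (simp only:) simp
  then show ?thesis by (simp add: U_0)
qed

text \<open>Pairing the recurrence with the iterates 1 to 4 gives linear equations, and period 15
  gives the symmetry between \<open>k\<close> and \<open>15 - k\<close>. The values at 1, 2, 3
  remain free.\<close>

lemma autocorr_relations:
  assumes v: "v \<in> E8_roots"
  shows "autocorr v 0 = 2" "autocorr v 4 = autocorr v 3 - autocorr v 1 + 1" "autocorr v 5 = -1" "autocorr v 6 = - 1 - autocorr v 3"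
    "autocorr v 7 = - autocorr v 3 - autocorr v 2" "autocorr v 8 = autocorr v 7" "autocorr v 9 = autocorr v 6" "autocorr v 10 = autocorr v 5"
proof -
  show 0: "autocorr v 0 = 2" using v by (simp add: autocorr_def U_0 E8_roots_def)
  have "U v 8 = U v 7 - U v 5 + U v 4 - U v 3 + U v 1 - U v 0" using U_recurrence[OF v, of 0] by simp
  then have *: "U v 8 \<bullet> U v j = U v 7 \<bullet> U v j - U v 5 \<bullet> U v j + U v 4 \<bullet> U v j - U v 3 \<bullet> U v j +
      U v 1 \<bullet> U v j - U v 0 \<bullet> U v j" for j
    by (simp add: inner_diff_left inner_add_left)
  have 1: "autocorr v 7 = autocorr v 6 - autocorr v 4 + autocorr v 3 - autocorr v 2 + 2 - autocorr v 1"
    and 2: "autocorr v 6 = autocorr v 5 - autocorr v 3" and 3: "autocorr v 5 = autocorr v 4 - 2 + autocorr v 1 - autocorr v 3"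
    and 4: "autocorr v 4 = autocorr v 3 - autocorr v 1 + 2 - autocorr v 1 + autocorr v 3 - autocorr v 4"
    using *[of 1] *[of 2] *[of 3] *[of 4] by (simp_all add: U_inner_U 0)
  show "autocorr v 4 = autocorr v 3 - autocorr v 1 + 1" using 4 by simp
  then show 5: "autocorr v 5 = -1" using 3 by simp
  then show "autocorr v 6 = - 1 - autocorr v 3" using 2 by simp
  then show "autocorr v 7 = - autocorr v 3 - autocorr v 2" using 1 4 by simp
  have "autocorr v (15 - k) = autocorr v k" if "k \<le> 15" for k
  proof -
    have "autocorr v (15 - k) = U v k \<bullet> U v 15" using that by (simp add: U_inner_U)
    also have "\<dots> = autocorr v k" using U_15[OF v] by (simp add: autocorr_def U_0 inner_commute)
    finally show ?thesis .
  qed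
  from this[of 7] this[of 6] this[of 5]
  show "autocorr v 8 = autocorr v 7" "autocorr v 9 = autocorr v 6" "autocorr v 10 = autocorr v 5" by simp_all
qed

lemma combination_nonzero:
  assumes "v \<in> E8_roots" "\<exists>i<8. c i \<noteq> 0"
  shows "(\<Sum>i<8. of_int (c i) *\<^sub>R U v i) \<noteq> 0"
  using independent[OF assms(1), of c] assms(2) by (auto simp: U_def)

lemma two_term_nonzero:
  assumes v: "v \<in> E8_roots" and k: "0 < k" "k < 8"
  shows "U v 0 + of_int e *\<^sub>R U v k \<noteq> 0"
proof -
  define c :: "nat \<Rightarrow> int" where "c i = (if i = 0 then 1 else if i = k then e else 0)" for i
  have "(\<Sum>i<8. of_int (c i) *\<^sub>R U v i) = (\<Sum>i\<in>{0, k}. of_int (c i) *\<^sub>R U v i)"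
    using k by (intro sum.mono_neutral_right) (auto simp: c_def)
  also have "\<dots> = U v 0 + of_int e *\<^sub>R U v k" using k by (simp add: c_def)
  finally show ?thesis using combination_nonzero[OF v, of c] by (force simp: c_def)
qed

text \<open>The sum and the difference of \<open>v\<close> and its \<open>k\<close>-th iterate are
  nonzero, so \<open>4 + 2 a\<close> and \<open>4 - 2 a\<close> are positive for the integer
  \<open>a = autocorr v k\<close>.\<close>

lemma autocorr_values:
  assumes v: "v \<in> E8_roots" and k: "0 < k" "k < 8"
  shows "autocorr v k \<in> {-1, 0, 1}"
proof -
  obtain n where n: "autocorr v k = of_int n"
    unfolding autocorr_def using E8_lattice_inner[OF U_lattice[OF v] U_lattice[OF v], of 0 k] by (auto elim: Ints_cases)
  have "0 < (U v 0 + of_int e *\<^sub>R U v k) \<bullet> (U v 0 + of_int e *\<^sub>R U v k)" for e :: int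
    using two_term_nonzero[OF v k] by simp
  then have "0 < 2 + 2 * of_int e * autocorr v k + of_int e * of_int e * 2" for e :: int
    using k by (simp add: inner_add_left inner_add_right U_inner_U autocorr_relations(1)[OF v] algebra_simps)
  from this[of 1] this[of "-1"] have "\<bar>n\<bar> < 2" by (simp add: n)
  then have "n = -1 \<or> n = 0 \<or> n = 1" by linarith
  then show ?thesis by (auto simp: n)
qed

lemma three_term_nonzero:
  assumes v: "v \<in> E8_roots" and k: "0 < j" "j < k" "k < 8"
  shows "U v 0 + of_int d *\<^sub>R U v j + of_int e *\<^sub>R U v k \<noteq> 0"
proof -
  define c :: "nat \<Rightarrow> int" where "c i = (if i = 0 then 1 else if i = j then d else if i = k then e else 0)" for i
  have "(\<Sum>i<8. of_int (c i) *\<^sub>R U v i) = (\<Sum>i\<in>{0, j, k}. of_int (c i) *\<^sub>R U v i)"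
    using k by (intro sum.mono_neutral_right) (auto simp: c_def)
  also have "\<dots> = U v 0 + of_int d *\<^sub>R U v j + of_int e *\<^sub>R U v k" using k by (simp add: c_def algebra_simps)
  finally show ?thesis using combination_nonzero[OF v, of c] by (force simp: c_def)
qed

lemma three_term_norm:
  assumes v: "v \<in> E8_roots" and k: "0 < j" "j < k" "k < 8"
  shows "2 + 2 * of_int d * of_int d + 2 * of_int e * of_int e + 2 * of_int d * autocorr v j + 2 * of_int e * autocorr v k +
    2 * of_int d * of_int e * autocorr v (k - j) > 0"
proof -
  have "0 < (U v 0 + of_int d *\<^sub>R U v j + of_int e *\<^sub>R U v k) \<bullet> (U v 0 + of_int d *\<^sub>R U v j + of_int e *\<^sub>R U v k)"
    using three_term_nonzero[OF assms] by simp
  also have "\<dots> = 2 + 2 * of_int d * of_int d + 2 * of_int e * of_int e + 2 * of_int d * autocorr v j + 2 * of_int e * autocorr v k +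
    2 * of_int d * of_int e * autocorr v (k - j)"
    using k by (simp add: inner_add_left inner_add_right U_inner_U autocorr_relations(1)[OF v] algebra_simps)
  finally show ?thesis .
qed

lemma root_combination:
  assumes "w \<in> E8_lattice" "autocorr w 0 = 2"
  shows "w \<in> E8_roots"
  using assms by (simp add: E8_roots_def autocorr_def U_0)

text \<open>The three values determine the others by \<open>autocorr_relations\<close>. Of the twelve triples that satisfy these
  relations, four would give a vanishing combination of three of the \<open>g\<^sup>i v\<close>.\<close>

lemma normalized_root_of:
  assumes v: "v \<in> E8_roots"
  shows "\<exists>w\<in>E8_roots. autocorr w 1 = 0 \<and> autocorr w 2 = 0 \<and> autocorr w 3 = 0"
proof -
  note autocorr = autocorr_relations[OF v] and lat = E8_lattice_add E8_lattice_diff U_lattice[OF v]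
  note expand = U_add U_diff U_U inner_add_left inner_add_right inner_diff_left inner_diff_right U_inner_U
  have step: ?thesis if "w \<in> E8_lattice" "autocorr w 0 = 2" "autocorr w 1 = 0" "autocorr w 2 = 0" "autocorr w 3 = 0" for w
    using root_combination that by blast
  define r1 where "r1 w \<longleftrightarrow> w \<in> E8_roots \<and> autocorr w 1 = -1 \<and> autocorr w 2 = 1 \<and> autocorr w 3 = -1" for w
  \<comment> \<open>The triple (-1, 1, -1) is treated once: case 2 starts with it, and case 3
    reaches it by passing to \<open>U v 0 - U v 7\<close>.\<close>
  have case1: "\<exists>w\<in>E8_roots. autocorr w 1 = 0 \<and> autocorr w 2 = 0 \<and> autocorr w 3 = 0" if "r1 v'" for v'
  proof -
    have v': "v' \<in> E8_roots" and a: "autocorr v' 1 = -1" "autocorr v' 2 = 1" "autocorr v' 3 = -1" using that by (auto simp: r1_def)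
    note autocorr' = autocorr_relations[OF v']
    let ?w = "U v' 0 + U v' 3"
    have "?w \<in> E8_lattice" by (intro E8_lattice_add U_lattice v')
    moreover have "autocorr ?w 0 = 2" "autocorr ?w 1 = 0" "autocorr ?w 2 = 0" "autocorr ?w 3 = 0"
      unfolding autocorr_def[of ?w] U_add U_U inner_add_left inner_add_right U_inner_U using autocorr' a by (simp_all flip: numeral_2_eq_2)
    ultimately show ?thesis using root_combination by blast
  qed
  consider
"autocorr v 1 = 0" "autocorr v 2 = 0" "autocorr v 3 = 0"
    | "autocorr v 1 = -1" "autocorr v 2 = 1" "autocorr v 3 = -1"
    | "autocorr v 1 = 0" "autocorr v 2 = 0" "autocorr v 3 = -1"
    | "autocorr v 1 = 0" "autocorr v 2 = 1" "autocorr v 3 = -1"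
    | "autocorr v 1 = 1" "autocorr v 2 = 0" "autocorr v 3 = -1"
    | "autocorr v 1 = 0" "autocorr v 2 = -1" "autocorr v 3 = 0"
    | "autocorr v 1 = 1" "autocorr v 2 = 0" "autocorr v 3 = 0"
    | "autocorr v 1 = 1" "autocorr v 2 = 1" "autocorr v 3 = 0"
  proof -
    have range: "autocorr v 1 \<in> {-1, 0, 1}" "autocorr v 2 \<in> {-1, 0, 1}" "autocorr v 3 \<in> {-1, 0, 1}"
      "autocorr v 4 \<in> {-1, 0, 1}" "autocorr v 6 \<in> {-1, 0, 1}" "autocorr v 7 \<in> {-1, 0, 1}"
      by (rule autocorr_values[OF v]; simp)+
    \<comment> \<open>In this order, the triples would give norm 0 to
      \<open>U v 0 + U v 3 - U v 7\<close>, \<open>U v 0 - U v 2 + U v 3\<close>,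
      \<open>U v 0 - U v 4 + U v 6\<close> and \<open>U v 0 + U v 6 - U v 7\<close>.\<close>
    have excluded: "\<not> (autocorr v 1 = -1 \<and> autocorr v 2 = 0 \<and> autocorr v 3 = -1)" "\<not> (autocorr v 1 = 1 \<and> autocorr v 2 = 1 \<and> autocorr v 3 = -1)"
      "\<not> (autocorr v 1 = 0 \<and> autocorr v 2 = 1 \<and> autocorr v 3 = 0)" "\<not> (autocorr v 1 = 1 \<and> autocorr v 2 = -1 \<and> autocorr v 3 = 0)"
      using three_term_norm[OF v, of 3 7 1 "-1"] three_term_norm[OF v, of 2 3 "-1" 1]
        three_term_norm[OF v, of 4 6 "-1" 1] three_term_norm[OF v, of 6 7 1 "-1"]
      by (auto simp: autocorr)
    show thesis
      using range(1-3) unfolding insert_iff empty_iff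
      by (elim disjE) (use range(4-6) excluded that autocorr in simp_all)
  qed
  then show ?thesis
  proof cases
    case 1
    with v show ?thesis by blast
  next
    case 2
    with v case1[of v] show ?thesis by (simp add: r1_def)
  next
    case 3
    let ?w = "U v 0 - U v 7"
    have "?w \<in> E8_lattice" by (intro lat)
    moreover have "autocorr ?w 0 = 2" "autocorr ?w 1 = -1" "autocorr ?w 2 = 1" "autocorr ?w 3 = -1"
      unfolding autocorr_def[of ?w] expand using autocorr 3 by (simp_all flip: numeral_2_eq_2)
    ultimately show ?thesis using root_combination[of ?w] case1[of ?w] by (simp add: r1_def)
  next
    case 4
    let ?w = "U v 0 - U v 2 + U v 4 - U v 6"
    have "?w \<in> E8_lattice" by (intro lat)
    moreover have "autocorr ?w 0 = 2" "autocorr ?w 1 = 0" "autocorr ?w 2 = 0" "autocorr ?w 3 = 0"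
      unfolding autocorr_def[of ?w] expand using autocorr 4 by (simp_all flip: numeral_2_eq_2)
    ultimately show ?thesis by (rule step)
  next
    case 5
    let ?w = "U v 0 + U v 4"
    have "?w \<in> E8_lattice" by (intro lat)
    moreover have "autocorr ?w 0 = 2" "autocorr ?w 1 = 0" "autocorr ?w 2 = 0" "autocorr ?w 3 = 0"
      unfolding autocorr_def[of ?w] expand using autocorr 5 by (simp_all flip: numeral_2_eq_2)
    ultimately show ?thesis by (rule step)
  next
    case 6
    let ?w = "U v 0 - U v 7"
    have "?w \<in> E8_lattice" by (intro lat)
    moreover have "autocorr ?w 0 = 2" "autocorr ?w 1 = 0" "autocorr ?w 2 = 0" "autocorr ?w 3 = 0"
      unfolding autocorr_def[of ?w] expand using autocorr 6 by (simp_all flip: numeral_2_eq_2)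
    ultimately show ?thesis by (rule step)
  next
    case 7
    let ?w = "U v 0 - U v 1 + U v 2"
    have "?w \<in> E8_lattice" by (intro lat)
    moreover have "autocorr ?w 0 = 2" "autocorr ?w 1 = 0" "autocorr ?w 2 = 0" "autocorr ?w 3 = 0"
      unfolding autocorr_def[of ?w] expand using autocorr 7 by (simp_all flip: numeral_2_eq_2)
    ultimately show ?thesis by (rule step)
  next
    case 8
    let ?w = "U v 0 - U v 2 + U v 3"
    have "?w \<in> E8_lattice" by (intro lat)
    moreover have "autocorr ?w 0 = 2" "autocorr ?w 1 = 0" "autocorr ?w 2 = 0" "autocorr ?w 3 = 0"
      unfolding autocorr_def[of ?w] expand using autocorr 8 by (simp_all flip: numeral_2_eq_2)
    ultimately show ?thesis by (rule step)
  qed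
qed

end

section \<open>Reduction of the lattice modulo 2\<close>

lemma E8_lattice_0: "0 \<in> E8_lattice"
  by (simp add: E8_lattice_def)

lemma E8_lattice_scale:
  assumes "x \<in> E8_lattice"
  shows "of_int n *\<^sub>R x \<in> E8_lattice"
proof -
  have nat: "of_nat m *\<^sub>R x \<in> E8_lattice" for m
    by (induction m) (simp_all add: E8_lattice_0 E8_lattice_add assms scaleR_add_left)
  show ?thesis
    using nat E8_lattice_uminus[OF nat] by (cases n rule: int_cases2) simp_all
qed

lemma E8_lattice_sum: "(\<And>i. i \<in> A \<Longrightarrow> f i \<in> E8_lattice) \<Longrightarrow> sum f A \<in> E8_lattice"
  by (induction A rule: infinite_finite_induct) (simp_all add: E8_lattice_0 E8_lattice_add)

definition gram :: "nat \<Rightarrow> nat \<Rightarrow> int" where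
  "gram i j = [2, 0, 0, 0, 1, -1, -1, 0] ! (if i \<le> j then j - i else i - j)"

text \<open>The inverse of the matrix \<open>gram\<close>. Its integrality reflects unimodularity
  and puts the dual basis into the lattice.\<close>

definition gram_inv :: "nat \<Rightarrow> nat \<Rightarrow> int" where
  "gram_inv i j =
    [[6, -2, -4, 2, -3, 4, 4, -4],
     [-2, 4, 2, -2, 1, -3, 0, 4],
     [-4, 2, 4, -2, 2, -3, -3, 4],
     [2, -2, -2, 2, -1, 2, 1, -3],
     [-3, 1, 2, -1, 2, -2, -2, 2],
     [4, -3, -3, 2, -2, 4, 2, -4],
     [4, 0, -3, 1, -2, 2, 4, -2],
     [-4, 4, 4, -3, 2, -4, -2, 6]] ! i ! j"

lemma less_8_cases: "i < 8 \<Longrightarrow> i \<in> {0, 1, 2, 3, 4, 5, 6, 7}" for i :: nat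
  by simp presburger

lemma sum_less_8: "(\<Sum>i<8. f i) = f 0 + f 1 + f 2 + f 3 + f 4 + f 5 + f 6 + f (7::nat)"
  by (simp add: eval_nat_numeral)

lemma gram_inverse:
  assumes "i < 8" "k < 8"
  shows "(\<Sum>j<8. gram i j * gram_inv j k) = of_bool (i = k)"
proof -
  have "\<forall>i\<in>{0, 1, 2, 3, 4, 5, 6, 7}. \<forall>k\<in>{0, 1, 2, 3, 4, 5, 6, 7}.
    (\<Sum>j<8. gram i j * gram_inv j k) = of_bool (i = k)"
    by (simp add: sum_less_8 gram_def gram_inv_def)
  then show ?thesis using assms less_8_cases by blast
qed

definition reduce :: "(nat \<Rightarrow> int) \<Rightarrow> vec8" where
  "reduce c = (of_int (c 0), of_int (c 1), of_int (c 2), of_int (c 3),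
    of_int (c 4), of_int (c 5), of_int (c 6), of_int (c 7))"

lemma bf_reduce: "bf (reduce c) (reduce d) = of_int (\<Sum>i<8. \<Sum>j<8. c i * d j * gram i j)"
  by (simp add: reduce_def sum_less_8 gram_def bit_simps)

text \<open>The diagonal of \<open>gram\<close> is even, so half the norm is an integral form; its
  signs disappear modulo 2.\<close>

lemma qf_reduce:
  obtains n where "(\<Sum>i<8. \<Sum>j<8. c i * c j * gram i j) = 2 * n" "qf (reduce c) = of_int n"
proof
  let ?n = "c 0 * c 0 + c 1 * c 1 + c 2 * c 2 + c 3 * c 3 + c 4 * c 4 + c 5 * c 5 + c 6 * c 6 + c 7 * c 7
    + (c 0 * c 4 + c 1 * c 5 + c 2 * c 6 + c 3 * c 7) - (c 0 * c 5 + c 1 * c 6 + c 2 * c 7) - (c 0 * c 6 + c 1 * c 7)"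
  show "(\<Sum>i<8. \<Sum>j<8. c i * c j * gram i j) = 2 * ?n"
    by (simp add: sum_less_8 gram_def algebra_simps)
  show "qf (reduce c) = of_int ?n"
    by (simp add: reduce_def bit_simps)
qed

lemma of_int_bit_eq_iff: "(of_int m :: bit) = of_int n \<longleftrightarrow> even (m - n)"
proof -
  have "(of_int k :: bit) = of_bool (odd k)" for k
    by (cases k rule: int_cases2) (simp_all add: of_nat_bit)
  then show ?thesis by simp
qed

lemma reduce_eqD: "reduce c = reduce d \<Longrightarrow> i < 8 \<Longrightarrow> even (c i - d i)"
  using less_8_cases[of i] by (auto simp only: reduce_def prod.inject of_int_bit_eq_iff insert_iff empty_iff)

locale E8_basis = E8_rotation +
  fixes v :: "real ^ 8"
  assumes v: "v \<in> E8_roots" and autocorr_0: "autocorr v 1 = 0" "autocorr v 2 = 0" "autocorr v 3 = 0"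
begin

lemma U_gram: "i < 8 \<Longrightarrow> j < 8 \<Longrightarrow> U v i \<bullet> U v j = of_int (gram i j)"
proof -
  have "\<forall>k\<in>{0, 1, 2, 3, 4, 5, 6, 7}. autocorr v k = of_int ([2, 0, 0, 0, 1, -1, -1, 0] ! k)"
    using autocorr_relations[OF v] autocorr_0 by simp
  then have "autocorr v k = of_int ([2, 0, 0, 0, 1, -1, -1, 0] ! k)" if "k < 8" for k
    using less_8_cases[OF that] by blast
  then show "i < 8 \<Longrightarrow> j < 8 \<Longrightarrow> U v i \<bullet> U v j = of_int (gram i j)"
    by (simp add: U_inner_U gram_def)
qed

abbreviation combination :: "(nat \<Rightarrow> int) \<Rightarrow> real ^ 8" where
  "combination c \<equiv> (\<Sum>i<8. of_int (c i) *\<^sub>R U v i)"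

lemma combination_lattice: "combination c \<in> E8_lattice"
  by (intro E8_lattice_sum E8_lattice_scale U_lattice v)

lemma combination_inner: "combination c \<bullet> combination d = of_int (\<Sum>i<8. \<Sum>j<8. c i * d j * gram i j)"
  by (simp add: inner_sum_left) (simp add: inner_sum_right sum_distrib_left U_gram mult.assoc)

definition dual :: "nat \<Rightarrow> real ^ 8" where
  "dual k = combination (\<lambda>j. gram_inv j k)"

lemma U_dual:
  assumes "i < 8" "k < 8"
  shows "U v i \<bullet> dual k = of_bool (i = k)"
proof -
  have "U v i \<bullet> dual k = of_int (\<Sum>j<8. gram i j * gram_inv j k)"
    using assms(1) by (simp add: dual_def inner_sum_right U_gram mult.commute)
  then show ?thesis by (simp add: gram_inverse[OF assms])
qed

lemma inj_U: "inj_on (U v) {..<8}"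
proof (rule inj_onI)
  fix i j :: nat assume ij: "i \<in> {..<8}" "j \<in> {..<8}" "U v i = U v j"
  have "(1::real) = of_bool (j = i)"
    using U_dual[of i i, unfolded ij(3)] U_dual[of j i] ij(1,2) by simp
  then show "i = j" by (cases "j = i") simp_all
qed

lemma span_U: "span (U v ` {..<8}) = UNIV"
proof -
  have "\<forall>i\<in>{..<8}. f (U v i) = 0" if "(\<Sum>x\<in>U v ` {..<8}. f x *\<^sub>R x) = 0" for f
  proof
    fix k :: nat assume k: "k \<in> {..<8}"
    have "0 = (\<Sum>i<8. f (U v i) *\<^sub>R U v i) \<bullet> dual k"
      using that by (simp add: sum.reindex[OF inj_U])
    also have "\<dots> = (\<Sum>i<8. f (U v i) * of_bool (i = k))"
      using k by (simp add: inner_sum_left U_dual)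
    also have "\<dots> = f (U v k)" using k by simp
    finally show "f (U v k) = 0" by simp
  qed
  then have "independent (U v ` {..<8})"
    by (intro independent_if_scalars_zero) auto
  moreover have "card (U v ` {..<8}) = DIM(real ^ 8)"
    using card_image[OF inj_U] by simp
  ultimately show ?thesis
    by (metis basis_card_eq_dim card_ge_dim_independent dim_UNIV order_refl subset_UNIV top.extremum_uniqueI)
qed

lemma expand_dual: "x = (\<Sum>k<8. (x \<bullet> dual k) *\<^sub>R U v k)"
proof -
  let ?h = "\<lambda>x. \<Sum>k<8. (x \<bullet> dual k) *\<^sub>R U v k"
  have "linear ?h"
    by (rule linearI) (simp_all add: inner_add_left scaleR_add_left sum.distrib scaleR_sum_right)
  moreover have "?h y = y" if "y \<in> U v ` {..<8}" for y
  proof -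
    from that obtain i where "i < 8" "y = U v i" by auto
    then show ?thesis by (simp add: U_dual if_distrib[of "\<lambda>c. c *\<^sub>R _"] of_bool_def cong: if_cong)
  qed
  ultimately have "?h x = id x"
    using linear_eq_on_span[of ?h id "U v ` {..<8}" x] linear_id span_U by auto
  then show ?thesis by simp
qed

definition coord :: "real ^ 8 \<Rightarrow> nat \<Rightarrow> int" where
  "coord x k = \<lfloor>x \<bullet> dual k\<rfloor>"

text \<open>The vectors \<open>dual k\<close> belong to the lattice, so
  \<open>x \<bullet> dual k\<close> is an integer and the floor in \<open>coord\<close> is exact.
  This shows that the eight iterates generate the full lattice.\<close>

lemma combination_coord:
  assumes "x \<in> E8_lattice"
  shows "combination (coord x) = x"
proof -
  have "x \<bullet> dual k \<in> \<int>" for k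
    using assms combination_lattice unfolding dual_def by (rule E8_lattice_inner)
  then show ?thesis by (subst (2) expand_dual) (simp add: coord_def)
qed

lemma coord_combination: "k < 8 \<Longrightarrow> coord (combination c) k = c k"
  by (simp add: coord_def inner_sum_left U_dual of_bool_def if_distrib cong: if_cong)

definition mod2_class :: "real ^ 8 \<Rightarrow> vec8" where
  "mod2_class x = reduce (coord x)"

lemma mod2_class_combination: "mod2_class (combination c) = reduce c"
  by (simp add: mod2_class_def reduce_def coord_combination)

lemma mod2_class_uminus:
  assumes "x \<in> E8_lattice"
  shows "mod2_class (- x) = mod2_class x"
proof -
  have "- x = combination (\<lambda>i. - coord x i)"
    using combination_coord[OF assms] by (simp add: sum_negf)
  then have "mod2_class (- x) = reduce (\<lambda>i. - coord x i)"
    by (simp only: mod2_class_combination)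
  then show ?thesis by (simp add: mod2_class_def reduce_def)
qed

lemma mod2_class_g:
  assumes "x \<in> E8_lattice"
  shows "mod2_class (g x) = sh (mod2_class x)"
proof -
  let ?c = "coord x"
  \<comment> \<open>The companion matrix of \<open>Phi15\<close>: coordinates move up by one place,
    and the last one is spread over the expression of \<open>U v 8\<close> by the
    recurrence.\<close>
  define d where "d i = [- ?c 7, ?c 0 + ?c 7, ?c 1, ?c 2 - ?c 7, ?c 3 + ?c 7, ?c 4 - ?c 7, ?c 5, ?c 6 + ?c 7] ! i" for i
  have "g (U v i) = U v (i + 1)" for i by (simp add: U_def)
  then have "g x = (\<Sum>i<8. of_int (?c i) *\<^sub>R U v (i + 1))"
    by (subst combination_coord[OF assms, symmetric])
      (simp add: linear_sum[OF linear_g] linear_scale[OF linear_g])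
  also have "\<dots> = combination d"
  proof -
    have U8: "U v 8 = U v 7 - U v 5 + U v 4 - U v 3 + U v 1 - U v 0"
      using U_recurrence[OF v, of 0] by simp
    show ?thesis
      by (simp add: sum_less_8 d_def U8 algebra_simps flip: numeral_2_eq_2)
  qed
  finally have "mod2_class (g x) = reduce d" by (simp only: mod2_class_combination)
  then show ?thesis by (simp add: mod2_class_def reduce_def d_def)
qed

lemma mod2_class_bf:
  assumes "x \<in> E8_lattice" "y \<in> E8_lattice"
  obtains m where "x \<bullet> y = of_int m" "bf (mod2_class x) (mod2_class y) = of_int m"
  using combination_inner[of "coord x" "coord y"] bf_reduce[of "coord x" "coord y"]
  by (simp only: combination_coord[OF assms(1)] combination_coord[OF assms(2)] flip: mod2_class_def)

lemma combination_norm: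
  obtains n where "combination c \<bullet> combination c = 2 * of_int n" "qf (reduce c) = of_int n"
proof -
  obtain n where "(\<Sum>i<8. \<Sum>j<8. c i * c j * gram i j) = 2 * n" "qf (reduce c) = of_int n"
    by (rule qf_reduce)
  with that show thesis by (simp add: combination_inner del: of_int_sum)
qed

lemma mod2_class_root:
  assumes "x \<in> E8_roots"
  shows "mod2_class x \<in> V.Q"
proof -
  have x: "x \<in> E8_lattice" "x \<bullet> x = 2" using assms by (simp_all add: E8_roots_def)
  obtain n where "x \<bullet> x = 2 * of_int n" "qf (mod2_class x) = of_int n"
    using combination_norm[of "coord x"] by (auto simp: combination_coord[OF x(1)] mod2_class_def)
  then show ?thesis using x(2) by (simp add: V.Q_def)
qed

lemma root_inner_bound:
  assumes "x \<in> E8_roots" "y \<in> E8_roots"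
  shows "\<bar>x \<bullet> y\<bar> \<le> 2" "x \<bullet> y = 2 \<Longrightarrow> x = y" "x \<bullet> y = - 2 \<Longrightarrow> x = - y"
proof -
  have n: "x \<bullet> x = 2" "y \<bullet> y = 2" using assms by (simp_all add: E8_roots_def)
  have "(x - y) \<bullet> (x - y) = 4 - 2 * (x \<bullet> y)" "(x + y) \<bullet> (x + y) = 4 + 2 * (x \<bullet> y)"
    by (simp_all add: inner_diff_left inner_diff_right inner_add_left inner_add_right n inner_commute)
  then show "\<bar>x \<bullet> y\<bar> \<le> 2" "x \<bullet> y = 2 \<Longrightarrow> x = y" "x \<bullet> y = - 2 \<Longrightarrow> x = - y"
    using inner_ge_zero[of "x - y"] inner_ge_zero[of "x + y"] inner_eq_zero_iff[of "x - y"] inner_eq_zero_iff[of "x + y"]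
    by (auto simp: add_eq_0_iff2)
qed

text \<open>Congruent roots differ by twice a lattice vector, whose norm is even, say
  \<open>2 n\<close>. Hence \<open>4 - 2 (x \<bullet> y) = 8 n\<close>, and the bound on
  \<open>x \<bullet> y\<close> leaves only \<open>n = 0\<close> and \<open>n = 1\<close>, the cases
  of equal and opposite roots.\<close>

lemma mod2_class_eq_imp:
  assumes x: "x \<in> E8_roots" and y: "y \<in> E8_roots" and eq: "mod2_class x = mod2_class y"
  shows "x = y \<or> x = - y"
proof -
  have lat: "x \<in> E8_lattice" "y \<in> E8_lattice" using x y by (simp_all add: E8_roots_def)
  define c where "c i = (coord x i - coord y i) div 2" for i
  have c: "coord x i = coord y i + 2 * c i" if "i < 8" for i
    using reduce_eqD[OF eq[unfolded mod2_class_def] that] by (simp add: c_def)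
  have "x = combination (coord x)" by (simp add: combination_coord[OF lat(1)])
  also have "\<dots> = (\<Sum>i<8. of_int (coord y i) *\<^sub>R U v i + 2 *\<^sub>R (of_int (c i) *\<^sub>R U v i))"
    by (rule sum.cong) (simp_all add: c scaleR_add_left)
  also have "\<dots> = y + 2 *\<^sub>R combination c"
    by (simp only: sum.distrib combination_coord[OF lat(2)] scaleR_sum_right)
  finally have xy: "x = y + 2 *\<^sub>R combination c" .
  obtain n where n: "combination c \<bullet> combination c = 2 * of_int n"
    by (rule combination_norm)
  have "x \<bullet> x = 2" "y \<bullet> y = 2" using x y by (simp_all add: E8_roots_def)
  moreover have "(x - y) \<bullet> (x - y) = 8 * of_int n"
    by (simp add: xy n)
  moreover have "(x - y) \<bullet> (x - y) = x \<bullet> x + y \<bullet> y - 2 * (x \<bullet> y)"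
    by (simp add: inner_diff_left inner_diff_right inner_commute)
  ultimately have i: "x \<bullet> y = 2 - 4 * of_int n" by simp
  have "0 \<le> combination c \<bullet> combination c" by simp
  then have "0 \<le> n" by (simp add: n)
  moreover have "real_of_int n \<le> 1" using root_inner_bound(1)[OF x y] by (simp add: i abs_if split: if_splits)
  ultimately have "n = 0 \<or> n = 1" by auto
  then show ?thesis using root_inner_bound(2,3)[OF x y] i by auto
qed

text \<open>Roots that are neither equal nor opposite have inner product -1, 0 or 1, so its parity
  decides orthogonality.\<close>

lemma mod2_class_orthogonal:
  assumes x: "x \<in> E8_roots" and y: "y \<in> E8_roots" and ne: "x \<noteq> y" "x \<noteq> - y"
  shows "bf (mod2_class x) (mod2_class y) = 0 \<longleftrightarrow> x \<bullet> y = 0"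
proof -
  obtain m where m: "x \<bullet> y = of_int m" "bf (mod2_class x) (mod2_class y) = of_int m"
    using x y by (auto simp: E8_roots_def intro: mod2_class_bf)
  have "\<bar>m\<bar> \<le> 2" "m \<noteq> 2" "m \<noteq> - 2"
    using root_inner_bound[OF x y] ne by (auto simp: m)
  then have "even m \<longleftrightarrow> m = 0" by presburger
  moreover have "(of_int m :: bit) = 0 \<longleftrightarrow> even m" using of_int_bit_eq_iff[of m 0] by simp
  ultimately show ?thesis using m by simp
qed

lemma mod2_class_pow:
  assumes "x \<in> E8_roots"
  shows "mod2_class (U x k) = (sh ^^ k) (mod2_class x)"
proof (induction k)
  case (Suc k)
  have "U x (Suc k) = g (U x k)" by (simp add: U_def)
  then show ?case using Suc mod2_class_g[OF U_lattice[OF assms]] by simp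
qed (simp add: U_def)

text \<open>The witnesses are the representatives themselves, with signs chosen so that the norm
  becomes 2.\<close>

lemma orbit_rep_lift: "\<exists>x\<in>E8_roots. mod2_class x = orbit_rep p"
proof -
  obtain c where c: "reduce ((!) c) = orbit_rep p" "(\<Sum>i<8. \<Sum>j<8. c ! i * c ! j * gram i j) = 2"
  proof -
    obtain a1 a2 a3 where p: "p = (a1, a2, a3)" by (cases p)
    have *: "\<exists>c. reduce ((!) c) = orbit_rep p \<and> (\<Sum>i<8. \<Sum>j<8. c ! i * c ! j * gram i j) = 2"
      unfolding p
    proof (cases a1; cases a2; cases a3; simp only:)
      show "\<exists>c. reduce ((!) c) = orbit_rep (0,0,0) \<and> (\<Sum>i<8. \<Sum>j<8. c ! i * c ! j * gram i j) = 2"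
        by (rule exI[of _ "[1,0,0,0,0,0,0,0]"]) (simp add: reduce_def sum_less_8 gram_def)
      show "\<exists>c. reduce ((!) c) = orbit_rep (0,0,1) \<and> (\<Sum>i<8. \<Sum>j<8. c ! i * c ! j * gram i j) = 2"
        by (rule exI[of _ "[1,1,0,0,-1,0,1,1]"]) (simp add: reduce_def sum_less_8 gram_def)
      show "\<exists>c. reduce ((!) c) = orbit_rep (0,1,0) \<and> (\<Sum>i<8. \<Sum>j<8. c ! i * c ! j * gram i j) = 2"
        by (rule exI[of _ "[1,0,0,0,-1,0,1,0]"]) (simp add: reduce_def sum_less_8 gram_def)
      show "\<exists>c. reduce ((!) c) = orbit_rep (0,1,1) \<and> (\<Sum>i<8. \<Sum>j<8. c ! i * c ! j * gram i j) = 2"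
        by (rule exI[of _ "[1,1,-1,0,-1,0,1,0]"]) (simp add: reduce_def sum_less_8 gram_def)
      show "\<exists>c. reduce ((!) c) = orbit_rep (1,0,0) \<and> (\<Sum>i<8. \<Sum>j<8. c ! i * c ! j * gram i j) = 2"
        by (rule exI[of _ "[1,1,0,0,0,0,1,1]"]) (simp add: reduce_def sum_less_8 gram_def)
      show "\<exists>c. reduce ((!) c) = orbit_rep (1,0,1) \<and> (\<Sum>i<8. \<Sum>j<8. c ! i * c ! j * gram i j) = 2"
        by (rule exI[of _ "[1,1,0,-1,-1,0,1,1]"]) (simp add: reduce_def sum_less_8 gram_def)
      show "\<exists>c. reduce ((!) c) = orbit_rep (1,1,0) \<and> (\<Sum>i<8. \<Sum>j<8. c ! i * c ! j * gram i j) = 2"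
        by (rule exI[of _ "[1,0,0,0,-1,0,0,0]"]) (simp add: reduce_def sum_less_8 gram_def)
      show "\<exists>c. reduce ((!) c) = orbit_rep (1,1,1) \<and> (\<Sum>i<8. \<Sum>j<8. c ! i * c ! j * gram i j) = 2"
        by (rule exI[of _ "[1,0,0,0,0,0,1,0]"]) (simp add: reduce_def sum_less_8 gram_def)
    qed
    with that show thesis by blast
  qed
  have "combination ((!) c) \<in> E8_roots"
    using c(2) combination_lattice by (simp add: E8_roots_def combination_inner del: of_int_sum)
  then show ?thesis using c(1) mod2_class_combination by metis
qed

text \<open>Lifts of the eight representatives are enough: powers of \<open>g\<close> carry them
  around the orbits.\<close>

lemma mod2_class_surj:
  assumes "y \<in> V.Q"
  shows "\<exists>x\<in>E8_roots. mod2_class x = y"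
proof -
  have "qf y = 1" using assms by (simp add: V.Q_def)
  then obtain k where y: "y = (sh ^^ k) (orbit_rep (orbit_type y))"
    using walk_orbit_rep[of y] by (auto simp: in_walk_iff)
  obtain x where "x \<in> E8_roots" "mod2_class x = orbit_rep (orbit_type y)" using orbit_rep_lift by blast
  then have "U x k \<in> E8_roots" "mod2_class (U x k) = y"
    using y by (simp_all add: U_root mod2_class_pow)
  then show ?thesis by blast
qed

end

section \<open>Rays and bases\<close>

lemma span_uminus_singleton: "span {- x} = span {x}" for x :: "'a::real_vector"
proof -
  have "- x \<in> span {x}" by (simp add: span_neg span_base)
  moreover have "x \<in> span {- x}" using span_neg[of "- x" "{- x}"] span_base[of "- x" "{- x}"] by simp
  ultimately show ?thesis by (simp add: span_eq)
qed

context E8_basis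
begin

text \<open>The choice is harmless, since the two roots on a ray are opposite and agree modulo
  2.\<close>

definition ray_vec :: "(real ^ 8) set \<Rightarrow> vec8" where
  "ray_vec R = mod2_class (SOME w. w \<in> E8_roots \<and> R = span {w})"

lemma rays_eq: "rays = (\<lambda>w. span {w}) ` E8_roots"
  by (simp add: rays_def gosset_vertices_eq)

lemma span_root_eq:
  assumes "w \<in> E8_roots" "x \<in> E8_roots" "span {w} = span {x}"
  shows "w = x \<or> w = - x"
proof -
  have "w \<in> span {x}" using assms(3) span_base[of w "{w}"] by simp
  then obtain c where c: "w = c *\<^sub>R x" by (auto simp: span_singleton)
  have "w \<bullet> w = c * c * (x \<bullet> x)" by (simp add: c)
  then have "c * c = 1" using assms(1,2) by (simp add: E8_roots_def)
  then have "c = 1 \<or> c = - 1" by (metis square_eq_1_iff)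
  then show ?thesis by (auto simp: c)
qed

lemma ray_vec_span:
  assumes w: "w \<in> E8_roots"
  shows "ray_vec (span {w}) = mod2_class w"
proof -
  define x where "x = (SOME x. x \<in> E8_roots \<and> span {w} = span {x})"
  have "x \<in> E8_roots \<and> span {w} = span {x}"
    unfolding x_def by (rule someI[of _ w]) (simp add: w)
  then have x: "x \<in> E8_roots" "w = x \<or> w = - x" using span_root_eq[OF w] by blast+
  then have "mod2_class w = mod2_class x"
    using mod2_class_uminus[of x] by (auto simp: E8_roots_def)
  then show ?thesis by (simp only: ray_vec_def x_def)
qed

lemma bij_ray_vec: "bij_betw ray_vec rays V.Q"
proof (rule bij_betw_imageI)
  show "inj_on ray_vec rays"
  proof (rule inj_onI)
    fix R S assume "R \<in> rays" "S \<in> rays" "ray_vec R = ray_vec S"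
    then obtain w x where "w \<in> E8_roots" "x \<in> E8_roots" "R = span {w}" "S = span {x}" "mod2_class w = mod2_class x"
      by (auto simp: rays_eq ray_vec_span)
    then show "R = S" using mod2_class_eq_imp[of w x] by (auto simp: span_uminus_singleton)
  qed
  have "ray_vec ` rays = mod2_class ` E8_roots"
    by (simp add: rays_eq image_image ray_vec_span)
  also have "\<dots> = V.Q" using mod2_class_root mod2_class_surj by blast
  finally show "ray_vec ` rays = V.Q" .
qed

lemma orthogonal_rays_iff:
  assumes R: "R \<in> rays" and S: "S \<in> rays" and ne: "R \<noteq> S"
  shows "orthogonal_rays R S \<longleftrightarrow> bf (ray_vec R) (ray_vec S) = 0"
proof -
  obtain w x where wx: "w \<in> E8_roots" "x \<in> E8_roots" "R = span {w}" "S = span {x}"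
    using R S by (auto simp: rays_eq)
  have "orthogonal_rays R S \<longleftrightarrow> w \<bullet> x = 0"
    unfolding orthogonal_rays_def wx by (auto simp: span_singleton orthogonal_def)
  moreover have "w \<noteq> x" "w \<noteq> - x" using ne wx by (auto simp: span_uminus_singleton)
  ultimately show ?thesis
    using mod2_class_orthogonal[of w x] wx by (simp add: ray_vec_span)
qed

lemma ray_g:
  assumes "R \<in> rays"
  shows "g ` R \<in> rays" "ray_vec (g ` R) = sh (ray_vec R)"
proof -
  obtain w where w: "w \<in> E8_roots" "R = span {w}" using assms by (auto simp: rays_eq)
  have gR: "g ` R = span {g w}" using linear_span_image[OF linear_g, of "{w}"] w by simp
  have gw: "g w \<in> E8_roots" using w roots by blast
  show "g ` R \<in> rays" using gw by (auto simp: rays_eq gR)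
  have "ray_vec (g ` R) = mod2_class (g w)" by (simp only: gR ray_vec_span[OF gw])
  also have "\<dots> = sh (mod2_class w)" using w(1) by (intro mod2_class_g) (simp add: E8_roots_def)
  also have "mod2_class w = ray_vec R" by (simp only: w(2) ray_vec_span[OF w(1)])
  finally show "ray_vec (g ` R) = sh (ray_vec R)" .
qed

text \<open>The predicate \<open>V.orth\<close> also tests each vector against itself, unlike
  \<open>pairwise\<close>; the two agree because \<open>bf\<close> is alternating.\<close>

lemma bases_iff:
  assumes B: "B \<subseteq> rays"
  shows "ray_vec ` B \<in> V.V_bases \<longleftrightarrow> B \<in> bases"
proof -
  have inj: "inj_on ray_vec B" using bij_ray_vec B by (auto simp: bij_betw_def intro: inj_on_subset)
  have "ray_vec ` B \<subseteq> V.Q" using bij_ray_vec B by (auto simp: bij_betw_def)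
  moreover have "(\<forall>x\<in>ray_vec ` B. \<forall>y\<in>ray_vec ` B. bf x y = 0) \<longleftrightarrow> pairwise orthogonal_rays B"
  proof -
    have "bf (ray_vec R) (ray_vec S) = 0 \<longleftrightarrow> R = S \<or> orthogonal_rays R S" if "R \<in> B" "S \<in> B" for R S
      using orthogonal_rays_iff[of R S] that B by (cases "R = S") auto
    then show ?thesis by (auto simp: pairwise_def)
  qed
  ultimately show ?thesis
    using B card_image[OF inj] by (auto simp: V.V_bases_def V.orth_def bases_def)
qed

lemma inj_on_image_rays: "inj_on ((`) ray_vec) (Pow rays)"
  using bij_ray_vec by (simp add: bij_betw_def inj_on_image_Pow)

lemma bij_bases: "bij_betw ((`) ray_vec) bases V.V_bases"
proof (rule bij_betw_imageI)
  have sub: "bases \<subseteq> Pow rays" by (auto simp: bases_def)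
  then show "inj_on ((`) ray_vec) bases" by (rule inj_on_subset[OF inj_on_image_rays])
  show "(`) ray_vec ` bases = V.V_bases"
  proof (intro equalityI subsetI)
    fix B' assume B': "B' \<in> V.V_bases"
    then have "B' \<subseteq> ray_vec ` rays" using bij_ray_vec by (auto simp: V.V_bases_def V.orth_def bij_betw_def)
    then obtain B where "B \<subseteq> rays" "B' = ray_vec ` B" by (auto simp: subset_image_iff)
    then show "B' \<in> (`) ray_vec ` bases" using bases_iff[of B] B' by blast
  qed (use sub bases_iff in auto)
qed

text \<open>The bijection \<open>ray_vec\<close> preserves incidence, matches the two notions of
  basis and intertwines \<open>g\<close> with \<open>sh\<close>, so it transports the count from the
  model.\<close>

theorem card_fifteen_fold: "card {X. parity_proof X \<and> fifteen_fold g X} = 2 ^ 130"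
proof -
  let ?F = "(`) ray_vec" and ?T = "\<lambda>B. (\<lambda>R. g ` R) ` B"
  define good where "good X \<longleftrightarrow> (`) sh ` X = X \<and> odd (card X) \<and> (\<forall>x\<in>V.Q. even (card {B \<in> X. x \<in> B}))" for X
  have bases_sub: "B \<subseteq> rays" if "B \<in> bases" for B using that by (simp add: bases_def)
  have inj_rays: "inj_on ray_vec rays" using bij_ray_vec by (simp add: bij_betw_def)
  have T_sub: "?T B \<subseteq> rays" if "B \<subseteq> rays" for B using that ray_g(1) by blast
  have F_T: "?F (?T B) = sh ` ?F B" if "B \<subseteq> rays" for B
    using that ray_g(2) by (force simp: image_image)
  have good_iff: "good (?F ` X) \<longleftrightarrow> parity_proof X \<and> fifteen_fold g X" if X: "X \<subseteq> bases" for X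
  proof -
    have XP: "X \<subseteq> Pow rays" using X bases_sub by auto
    have injX: "inj_on ?F X" using XP by (rule inj_on_subset[OF inj_on_image_rays])
    have card: "card (?F ` X) = card X" using injX by (rule card_image)
    have inc: "card {B \<in> ?F ` X. ray_vec R \<in> B} = card {B \<in> X. R \<in> B}" if R: "R \<in> rays" for R
    proof -
      have "ray_vec R \<in> ray_vec ` B \<longleftrightarrow> R \<in> B" if "B \<in> X" for B
        using inj_on_image_mem_iff[OF inj_rays R] that XP by auto
      then have "{B \<in> ?F ` X. ray_vec R \<in> B} = ?F ` {B \<in> X. R \<in> B}" by auto
      then show ?thesis using card_image[OF inj_on_subset[OF injX], of "{B \<in> X. R \<in> B}"] by simp
    qed
    have "(\<forall>x\<in>V.Q. even (card {B \<in> ?F ` X. x \<in> B})) \<longleftrightarrow> (\<forall>R\<in>rays. even (card {B \<in> ?F ` X. ray_vec R \<in> B}))"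
    proof -
      have "V.Q = ray_vec ` rays" using bij_ray_vec by (simp add: bij_betw_def)
      then show ?thesis by (simp only: ball_simps)
    qed
    also have "\<dots> \<longleftrightarrow> (\<forall>R\<in>rays. even (card {B \<in> X. R \<in> B}))" using inc by simp
    finally have par: "(\<forall>x\<in>V.Q. even (card {B \<in> ?F ` X. x \<in> B})) \<longleftrightarrow> (\<forall>R\<in>rays. even (card {B \<in> X. R \<in> B}))" .
    have "(`) sh ` ?F ` X = ?F ` ?T ` X"
      using F_T XP by (simp add: image_image subset_iff)
    moreover have "?F ` ?T ` X = ?F ` X \<longleftrightarrow> ?T ` X = X"
      by (rule inj_on_image_eq_iff[OF inj_on_image_rays]) (use XP T_sub in auto)
    ultimately show ?thesis
      using X par card by (auto simp: good_def parity_proof_def fifteen_fold_def)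
  qed
  have "bij_betw ((`) ?F) (Pow bases) (Pow V.V_bases)"
    using bij_bases by (rule bij_betw_Pow)
  then have inj: "inj_on ((`) ?F) (Pow bases)" and surj: "(`) ?F ` Pow bases = Pow V.V_bases"
    by (simp_all add: bij_betw_def)
  have "{X. parity_proof X \<and> fifteen_fold g X} = {X \<in> Pow bases. good (?F ` X)}"
    using good_iff by (auto simp: parity_proof_def)
  moreover have "card {X \<in> Pow bases. good (?F ` X)} = card ((`) ?F ` {X \<in> Pow bases. good (?F ` X)})"
    by (rule card_image[symmetric], rule inj_on_subset[OF inj]) auto
  moreover have "(`) ?F ` {X \<in> Pow bases. good (?F ` X)} = {Y \<in> (`) ?F ` Pow bases. good Y}"
    by blast
  moreover have "{Y \<in> (`) ?F ` Pow bases. good Y} = {X. X \<subseteq> V.V_bases \<and> (`) sh ` X = X \<and> odd (card X) \<and> (\<forall>x\<in>V.Q. even (card {B \<in> X. x \<in> B}))}"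
    unfolding surj by (auto simp: good_def)
  ultimately show ?thesis using V_count by simp
qed

end

theorem mainTheorem5:
  fixes P :: "(real ^ 8) set" and g :: "real ^ 8 \<Rightarrow> real ^ 8"
  assumes "triacontagonal_plane P"
    and "polytope_symmetry g"
    and "rotates_plane_by g P (24 * pi / 180)"
  shows "card {X. parity_proof X \<and> fifteen_fold g X} = 2 ^ 130"
proof -
  interpret E8_rotation g using assms by (rule E8_rotationI)
  \<comment> \<open>Some root is needed to start the normalization; eight coordinates 1/2 have sum 4
    and squared norm 2.\<close>
  have "vec (1/2) \<in> E8_roots"
    by (simp add: E8_roots_def E8_lattice_def inner_vec_def)
  then obtain v where "v \<in> E8_roots" "autocorr v 1 = 0" "autocorr v 2 = 0" "autocorr v 3 = 0"
    using normalized_root_of by blast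
  then interpret E8_basis g v by unfold_locales
  show ?thesis by (rule card_fifteen_fold)
qed

end
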